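(* Let $G$ be a finitely generated, virtually nilpotent group. Then $G$ admits a box space of finite asymptotic dimension, i.e. there is a regular approximation $\sigma$ of $G$ such that $\operatorname{asdim}(\square_\sigma G)<\infty$.
   Context: A group is virtually nilpotent if it contains a nilpotent subgroup of finite index. **Regular approximations.** Let $G$ be a countable discrete group. A decreasing sequence $\sigma=(G_n)_n$ of finite-index subgroups of $G$ ($G_{n+1}\le G_n$) is a *regular approximation* of $G$ if it is semi-conjugacy-separating: for every $g\in G\setminus\{1\}$ there is $n$ with $G_n\cap g^G G_n=\varnothing$, where $g^G$ is the conjugacy class of $g$ (equivalently $\bigcap_n\bigcup_{k\in G}kG_nk^{-1}=\{1\}$). **Box space.** Fix a proper (balls are finite) right-invariant metric $d$ on $G$. On $G/G_n$ (left cosets) put the quotient metric $d_n(xG_n,yG_n)=\inf\{d(xh_1,yh_2): h_1,h_2\in G_n\}$. The box space $\square_\sigma G$ is the coarse disjoint union of the $(G/G_n,d_n)$: the set $\bigsqcup_n G/G_n$ with a metric $d^B$ restricting to $d_n$ on each $G/G_n$ and with $\operatorname{dist}_{d^B}(G/G_n,G/G_m)\to\infty$ as $n\neq m$, $n+m\to\infty$. Its coarse equivalence class does not depend on $d$, $d^B$. **Asymptotic dimension.** $\operatorname{asdim}(X)$ is the smallest $s\in\mathbb N$ (including $0$; $\infty$ if none) such that for every $R>0$ there is a uniformly bounded cover $\mathcal V=\mathcal V^{(0)}\cup\dots\cup\mathcal V^{(s)}$ of $X$ with Lebesgue number at least $R$ and each $\mathcal V^{(l)}$ consisting of pairwise disjoint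 sets. *)

theory Defs
  imports
    "HOL-Analysis.Abstract_Metric_Spaces"
    "HOL-Library.Extended_Nat"
    "HOL-Algebra.Generated_Groups"
    "HOL-Algebra.Left_Coset"
begin

section \<open>Group-theoretic notions\<close>

definition finitely_generated_group :: "('a, 'b) monoid_scheme \<Rightarrow> bool" where
  "finitely_generated_group G \<longleftrightarrow>
     group G \<and> (\<exists>S. finite S \<and> S \<subseteq> carrier G \<and> generate G S = carrier G)"

primrec lower_central :: "('a, 'b) monoid_scheme \<Rightarrow> nat \<Rightarrow> 'a set" where
  "lower_central G 0 = carrier G"
| "lower_central G (Suc k) =
     generate G (\<Union>x \<in> carrier G. \<Union>y \<in> lower_central G k.
       {x \<otimes>\<^bsub>G\<^esub> y \<otimes>\<^bsub>G\<^esub> inv\<^bsub>G\<^esub> x \<otimes>\<^bsub>G\<^esub> inv\<^bsub>G\<^esub> y})"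

definition nilpotent_group :: "('a, 'b) monoid_scheme \<Rightarrow> bool" where
  "nilpotent_group G \<longleftrightarrow> group G \<and> (\<exists>k. lower_central G k = {\<one>\<^bsub>G\<^esub>})"

definition finite_index_subgroup :: "'a set \<Rightarrow> ('a, 'b) monoid_scheme \<Rightarrow> bool" where
  "finite_index_subgroup H G \<longleftrightarrow> subgroup H G \<and> finite (lcosets\<^bsub>G\<^esub> H)"

definition virtually_nilpotent_group :: "('a, 'b) monoid_scheme \<Rightarrow> bool" where
  "virtually_nilpotent_group G \<longleftrightarrow>
     group G \<and> (\<exists>H. finite_index_subgroup H G \<and> nilpotent_group (G\<lparr>carrier := H\<rparr>))"

definition conjugacy_class :: "('a, 'b) monoid_scheme \<Rightarrow> 'a \<Rightarrow> 'a set" where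
  "conjugacy_class G g = {k \<otimes>\<^bsub>G\<^esub> g \<otimes>\<^bsub>G\<^esub> inv\<^bsub>G\<^esub> k | k. k \<in> carrier G}"

definition regular_approximation ::
    "('a, 'b) monoid_scheme \<Rightarrow> (nat \<Rightarrow> 'a set) \<Rightarrow> bool" where
  "regular_approximation G \<sigma> \<longleftrightarrow>
     (\<forall>n. finite_index_subgroup (\<sigma> n) G) \<and>
     (\<forall>n. \<sigma> (Suc n) \<subseteq> \<sigma> n) \<and>
     (\<forall>g \<in> carrier G - {\<one>\<^bsub>G\<^esub>}. \<exists>n. \<sigma> n \<inter> (conjugacy_class G g <#>\<^bsub>G\<^esub> \<sigma> n) = {})"


section \<open>Box spaces\<close>

definition proper_right_invariant_metric ::
    "('a, 'b) monoid_scheme \<Rightarrow> ('a \<Rightarrow> 'a \<Rightarrow> real) \<Rightarrow> bool" where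
  "proper_right_invariant_metric G d \<longleftrightarrow>
     Metric_space (carrier G) d \<and>
     (\<forall>x \<in> carrier G. \<forall>r. finite (Metric_space.mcball (carrier G) d x r)) \<and>
     (\<forall>x \<in> carrier G. \<forall>y \<in> carrier G. \<forall>g \<in> carrier G.
        d (x \<otimes>\<^bsub>G\<^esub> g) (y \<otimes>\<^bsub>G\<^esub> g) = d x y)"

text \<open>
  For left cosets \<open>A = x <# H\<close> and \<open>B = y <# H\<close> the following infimum is exactly the quotient
  metric \<open>inf {d (x h1) (y h2) | h1 h2 \<in> H}\<close>. It is only used for nonempty \<open>A\<close>, \<open>B\<close> and
  nonnegative \<open>d\<close>.
\<close>

definition set_distance :: "('x \<Rightarrow> 'x \<Rightarrow> real) \<Rightarrow> 'x set \<Rightarrow> 'x set \<Rightarrow> real" where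
  "set_distance d A B = Inf {d a b | a b. a \<in> A \<and> b \<in> B}"

text \<open>
  The disjoint union of the coset spaces: the point \<open>(n, X)\<close> is the coset \<open>X\<close> in the \<open>n\<close>-th
  component, so equal subgroups at different indices still give disjoint components.
\<close>

definition box_component ::
    "('a, 'b) monoid_scheme \<Rightarrow> (nat \<Rightarrow> 'a set) \<Rightarrow> nat \<Rightarrow> (nat \<times> 'a set) set" where
  "box_component G \<sigma> n = {n} \<times> (lcosets\<^bsub>G\<^esub> (\<sigma> n))"

definition box_space ::
    "('a, 'b) monoid_scheme \<Rightarrow> (nat \<Rightarrow> 'a set) \<Rightarrow> (nat \<times> 'a set) set" where
  "box_space G \<sigma> = (\<Union>n. box_component G \<sigma> n)"

definition box_space_metric ::
    "('a, 'b) monoid_scheme \<Rightarrow> (nat \<Rightarrow> 'a set) \<Rightarrow> ('a \<Rightarrow> 'a \<Rightarrow> real) \<Rightarrow>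
     (nat \<times> 'a set \<Rightarrow> nat \<times> 'a set \<Rightarrow> real) \<Rightarrow> bool" where
  "box_space_metric G \<sigma> d dB \<longleftrightarrow>
     Metric_space (box_space G \<sigma>) dB \<and>
     (\<forall>n. \<forall>X \<in> lcosets\<^bsub>G\<^esub> (\<sigma> n). \<forall>Y \<in> lcosets\<^bsub>G\<^esub> (\<sigma> n).
        dB (n, X) (n, Y) = set_distance d X Y) \<and>
     (\<forall>C. \<exists>N. \<forall>n m. n \<noteq> m \<and> n + m \<ge> N \<longrightarrow>
        set_distance dB (box_component G \<sigma> n) (box_component G \<sigma> m) \<ge> C)"


section \<open>Asymptotic dimension\<close>

definition uniformly_bounded :: "('x \<Rightarrow> 'x \<Rightarrow> real) \<Rightarrow> 'x set set \<Rightarrow> bool" where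
  "uniformly_bounded d \<U> \<longleftrightarrow> (\<exists>B. \<forall>U \<in> \<U>. \<forall>x \<in> U. \<forall>y \<in> U. d x y \<le> B)"

text \<open>
  Every nonempty subset of diameter less than \<open>R\<close> lies in a member of the cover; the bound
  \<open>r < R\<close> on all pairwise distances expresses that their supremum is less than \<open>R\<close>.
\<close>

definition Lebesgue_number_at_least ::
    "'x set \<Rightarrow> ('x \<Rightarrow> 'x \<Rightarrow> real) \<Rightarrow> 'x set set \<Rightarrow> real \<Rightarrow> bool" where
  "Lebesgue_number_at_least M d \<U> R \<longleftrightarrow>
     (\<forall>A. A \<subseteq> M \<and> A \<noteq> {} \<and> (\<exists>r<R. \<forall>x \<in> A. \<forall>y \<in> A. d x y \<le> r) \<longrightarrow> (\<exists>U \<in> \<U>. A \<subseteq> U))"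

definition asdim_at_most :: "'x set \<Rightarrow> ('x \<Rightarrow> 'x \<Rightarrow> real) \<Rightarrow> nat \<Rightarrow> bool" where
  "asdim_at_most M d s \<longleftrightarrow>
     (\<forall>R>0. \<exists>\<V> :: nat \<Rightarrow> 'x set set.
        (\<Union>l\<le>s. \<Union>(\<V> l)) = M \<and>
        uniformly_bounded d (\<Union>l\<le>s. \<V> l) \<and>
        Lebesgue_number_at_least M d (\<Union>l\<le>s. \<V> l) R \<and>
        (\<forall>l\<le>s. pairwise disjnt (\<V> l)))"

text \<open>The infimum of the empty set in \<^typ>\<open>enat\<close> is \<open>\<infinity>\<close>.\<close>

definition asdim :: "'x set \<Rightarrow> ('x \<Rightarrow> 'x \<Rightarrow> real) \<Rightarrow> enat" where
  "asdim M d = Inf {enat s | s. asdim_at_most M d s}"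

end

theory Submission
  imports Defs
begin

text \<open>
  Let \<open>S\<close> be a finite symmetric generating set of \<open>G\<close> and \<open>B r\<close> the set of products of at most \<open>r\<close>
  elements of \<open>S\<close>. As \<open>G\<close> has polynomial growth, there is a constant \<open>M\<close> with
  \<open>|B (7r)| \<le> M |B r|\<close> for arbitrarily large \<open>r\<close>. For such \<open>r\<close> and any finite index subgroup \<open>L\<close>,
  translates \<open>B (3r) z\<close> along a maximal \<open>2r\<close>-separated set of \<open>z \<in> G/L\<close> cover \<open>G/L\<close> with
  Lebesgue number about \<open>r\<close>, and each meets at most \<open>M\<close> of them, so they can be coloured with \<open>M + 1\<close>
  colours. The bound does not depend on \<open>L\<close>, hence every box space of \<open>G\<close> has asymptotic dimension
  at most \<open>M\<close>.

  Polynomial growth and residual finiteness of nilpotent groups are both obtained by splitting off one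
  generator \<open>x\<close> at a time: with \<open>U\<close> the finite set of iterated commutators of \<open>x\<close> with the other
  generators, \<open>N = \<langle>U\<rangle>\<close> is normalised by \<open>x\<close>, the whole group is \<open>N\<langle>x\<rangle>\<close>, and conjugation by \<open>x ^ a\<close>
  increases word lengths over \<open>U\<close> only by a factor polynomial in \<open>a\<close>.
\<close>

context group
begin

lemma inv_cancel_left:
  assumes "x \<in> carrier G" "y \<in> carrier G"
  shows "inv x \<otimes> (x \<otimes> y) = y" "x \<otimes> (inv x \<otimes> y) = y"
  using assms by (simp_all flip: m_assoc)

end

section \<open>Word balls\<close>

text \<open>Inserting \<open>\<one>\<close> turns products of exactly \<open>n\<close> letters into
  products of at most \<open>n\<close>. Inverses are not built in, so the growth argument only meets
  nonnegative powers of the split-off generator.\<close>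

primrec word_ball :: "('a, 'b) monoid_scheme \<Rightarrow> 'a set \<Rightarrow> nat \<Rightarrow> 'a set" where
  "word_ball G S 0 = {\<one>\<^bsub>G\<^esub>}"
| "word_ball G S (Suc n) = word_ball G S n <#>\<^bsub>G\<^esub> insert \<one>\<^bsub>G\<^esub> S"

context group
begin

lemma word_ball_subset_carrier:
  assumes "S \<subseteq> carrier G"
  shows "word_ball G S n \<subseteq> carrier G"
  by (induction n) (use assms in \<open>auto simp: set_mult_closed\<close>)

lemma finite_word_ball: "finite S \<Longrightarrow> finite (word_ball G S n)"
  by (induction n) (auto simp: set_mult_def)

lemma one_in_word_ball: "\<one> \<in> word_ball G S n"
  by (induction n) (auto simp: set_mult_def intro!: bexI[of _ \<one>])

lemma word_ball_add:
  assumes S: "S \<subseteq> carrier G"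
  shows "word_ball G S (m + n) = word_ball G S m <#> word_ball G S n"
proof (induction n)
  case 0
  show ?case
    using word_ball_subset_carrier[OF S, of m] by (force simp: set_mult_def subset_iff)
next
  case (Suc n)
  then show ?case
    using word_ball_subset_carrier[OF S] S by (simp add: set_mult_assoc)
qed

lemma word_ball_mult:
  assumes "S \<subseteq> carrier G" "a \<in> word_ball G S m" "b \<in> word_ball G S n"
  shows "a \<otimes> b \<in> word_ball G S (m + n)"
  using assms by (auto simp: word_ball_add set_mult_def)

lemma word_ball_mono:
  assumes "S \<subseteq> carrier G" "m \<le> n"
  shows "word_ball G S m \<subseteq> word_ball G S n"
proof
  fix a assume a: "a \<in> word_ball G S m"
  then have "a \<otimes> \<one> \<in> word_ball G S (m + (n - m))"
    using assms by (intro word_ball_mult one_in_word_ball)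
  moreover have "a \<in> carrier G"
    using a word_ball_subset_carrier[OF assms(1)] by blast
  ultimately show "a \<in> word_ball G S n"
    using assms by simp
qed

lemma word_ball_1: 
  assumes "S \<subseteq> carrier G" shows "word_ball G S (Suc 0) = insert \<one> S"
  using assms by (force simp: set_mult_def)

lemma word_ball_incl:
  assumes "S \<subseteq> carrier G" "s \<in> S" "0 < n"
  shows "s \<in> word_ball G S n"
  using word_ball_mono[OF assms(1), of "Suc 0" n] assms word_ball_1[OF assms(1)] by auto

lemma word_ball_inv:
  assumes S: "S \<subseteq> carrier G" and inv: "\<And>s. s \<in> S \<Longrightarrow> inv s \<in> S"
  shows "w \<in> word_ball G S n \<Longrightarrow> inv w \<in> word_ball G S n"
proof (induction n arbitrary: w)
  case (Suc n)
  then obtain v s where vs: "v \<in> word_ball G S n" "s \<in> insert \<one> S" "w = v \<otimes> s"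
    by (auto simp: set_mult_def)
  have "inv s \<in> word_ball G S (Suc 0)"
    using vs(2) inv unfolding word_ball_1[OF S] by auto
  then have "inv s \<otimes> inv v \<in> word_ball G S (Suc 0 + n)"
    using Suc.IH[OF vs(1)] S by (intro word_ball_mult)
  moreover have "inv w = inv s \<otimes> inv v"
    using vs S word_ball_subset_carrier[OF S, of n] by (auto simp: inv_mult_group subset_iff)
  ultimately show ?case by simp
qed simp

lemma word_ball_subset_generate: "S \<subseteq> carrier G \<Longrightarrow> word_ball G S n \<subseteq> generate G S"
  by (induction n) (auto simp: set_mult_def intro: generate.intros)

lemma generate_subset_word_balls:
  assumes S: "S \<subseteq> carrier G" and inv: "\<And>s. s \<in> S \<Longrightarrow> inv s \<in> S"
  shows "generate G S \<subseteq> (\<Union>n. word_ball G S n)"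
proof
  fix g assume "g \<in> generate G S"
  then show "g \<in> (\<Union>n. word_ball G S n)"
  proof induction
    case one
    then show ?case using one_in_word_ball by blast
  next
    case (incl h)
    then show ?case using word_ball_incl[OF S, of h "Suc 0"] by blast
  next
    case (inv h)
    then show ?case using assms(2) word_ball_incl[OF S, of "inv h" "Suc 0"] by blast
  next
    case (eng a b)
    then show ?case using word_ball_mult[OF S] by blast
  qed
qed

end

section \<open>Induction over finite subsets of a nilpotent group\<close>

text \<open>The fixed element \<open>x\<close> comes first, so that
  \<open>commutator_with G x\<close> is a self-map that can be iterated with
  \<open>^^\<close>.\<close>

definition commutator_with :: "('a, 'b) monoid_scheme \<Rightarrow> 'a \<Rightarrow> 'a \<Rightarrow> 'a" where
  "commutator_with G x t = x \<otimes>\<^bsub>G\<^esub> t \<otimes>\<^bsub>G\<^esub> inv\<^bsub>G\<^esub> x \<otimes>\<^bsub>G\<^esub> inv\<^bsub>G\<^esub> t"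

context group
begin

lemma commutator_with_closed [simp]:
  "x \<in> carrier G \<Longrightarrow> t \<in> carrier G \<Longrightarrow> commutator_with G x t \<in> carrier G"
  by (simp add: commutator_with_def)

lemma conj_eq_commutator:
  assumes "x \<in> carrier G" "t \<in> carrier G"
  shows "x \<otimes> t \<otimes> inv x = commutator_with G x t \<otimes> t"
  using assms by (simp add: commutator_with_def m_assoc)

lemma lower_central_subset_carrier: "lower_central G k \<subseteq> carrier G"
proof (induction k)
  case (Suc k)
  show ?case
    unfolding lower_central.simps(2) by (rule generate_incl) (use Suc.IH in auto)
qed simp

lemma lower_central_Suc_subset: "lower_central G (Suc k) \<subseteq> lower_central G k"
proof (induction k)
  case 0
  then show ?case using lower_central_subset_carrier[of "Suc 0"] by simp
next
  case (Suc k)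
  show ?case
    by (subst (1 2) lower_central.simps(2), rule mono_generate) (use Suc.IH in blast)
qed

lemma lower_central_mono:
  assumes "i \<le> j"
  shows "lower_central G j \<subseteq> lower_central G i"
  using assms by (induction rule: dec_induct) (use lower_central_Suc_subset in blast)+

lemma commutator_with_lower_central:
  assumes "x \<in> carrier G" "t \<in> lower_central G k"
  shows "commutator_with G x t \<in> lower_central G (Suc k)"
  using assms by (auto simp: commutator_with_def intro!: generate.incl)

lemma iterated_commutator_lower_central:
  assumes "x \<in> carrier G" "t \<in> lower_central G k"
  shows "(commutator_with G x ^^ j) t \<in> lower_central G (k + j)"
  using assms
  by (induction j) (auto intro: commutator_with_lower_central simp del: lower_central.simps)

text \<open>Each commutator descends one step in the lower central series, so after \<open>c\<close>
  of them only \<open>\<one>\<close> is left.\<close>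

lemma iterated_commutator_eq_one:
  assumes "lower_central G c = {\<one>}" "x \<in> carrier G" "t \<in> carrier G" "c \<le> j"
  shows "(commutator_with G x ^^ j) t = \<one>"
proof -
  have "(commutator_with G x ^^ j) t \<in> lower_central G j"
    using iterated_commutator_lower_central[of x t 0 j] assms(2,3) by simp
  then show ?thesis using lower_central_mono[OF assms(4)] assms(1) by blast
qed

text \<open>
  Call weight of an element the largest index of a lower central subgroup containing it.
  Replacing \<open>x\<close>, of minimal weight \<open>i\<close> in \<open>insert x S\<close>, by the iterated commutators of \<open>x\<close> with \<open>S\<close>
  removes one element of weight \<open>i\<close> and only adds elements of larger weight. So the numbers of elements
  of weight \<open>0, 1, \<dots>, c - 1\<close> decrease lexicographically.
\<close>

lemma nilpotent_finite_induct [consumes 3, case_names trivial insert]: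
  assumes nil: "lower_central G c = {\<one>}" and "finite S" "S \<subseteq> carrier G"
    and trivial: "\<And>S. S \<subseteq> {\<one>} \<Longrightarrow> P S"
    and insert: "\<And>x S U. \<lbrakk>x \<in> carrier G; finite U; U \<subseteq> carrier G; S \<subseteq> U;
      U \<subseteq> generate G (insert x S);
      \<forall>t\<in>U. commutator_with G x t \<in> U; P U\<rbrakk> \<Longrightarrow> P (insert x S)"
  shows "P S"
proof -
  have main: "P S" if "i \<le> c" "finite S" "S \<subseteq> lower_central G i" for i S
    using that
  \<comment> \<open>All elements of \<open>S\<close> have weight at least \<open>i\<close>. The
    outer induction raises \<open>i\<close>; the inner one removes the elements of weight exactly
    \<open>i\<close>, those outside \<open>lower_central G (Suc i)\<close>.\<close>
  proof (induction "c - i" arbitrary: i S)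
    case 0
    then have "S \<subseteq> {\<one>}" using nil by simp
    then show ?case by (rule trivial)
  next
    case (Suc d)
    note outer = Suc.hyps(1)
    have d: "d = c - Suc i" "Suc i \<le> c" using Suc.hyps(2) by auto
    show ?case
      using Suc.prems(2,3)
    proof (induction "card (S - lower_central G (Suc i))" arbitrary: S rule: less_induct)
      case less
      show ?case
      proof (cases "S \<subseteq> lower_central G (Suc i)")
        case True
        then show ?thesis using outer[OF d] less.prems by blast
      next
        case False
        then obtain x where x: "x \<in> S" "x \<notin> lower_central G (Suc i)" by blast
        have xG: "x \<in> carrier G"
          using x less.prems lower_central_subset_carrier[of i] by blast
        let ?f = "commutator_with G x"
        \<comment> \<open>The iterates with \<open>j = 0\<close> keep \<open>S - {x}\<close> inside
          \<open>U\<close>, and taking all \<open>j\<close> makes \<open>U\<close> closed under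
          \<open>?f\<close>. It is finite because the iterates from \<open>c\<close> on are
          \<open>\<one>\<close>.\<close>
        define U where "U = (\<Union>j. (?f ^^ j) ` (S - {x}))"
        have Uc: "U \<subseteq> insert \<one> (\<Union>j<c. (?f ^^ j) ` (S - {x}))"
        proof
          fix u assume "u \<in> U"
          then obtain j s where js: "s \<in> S - {x}" "u = (?f ^^ j) s" by (auto simp: U_def)
          have "s \<in> carrier G" using js less.prems lower_central_subset_carrier[of i] by blast
          then show "u \<in> insert \<one> (\<Union>j<c. (?f ^^ j) ` (S - {x}))"
            using iterated_commutator_eq_one[OF nil xG, of s j] js by (cases "j < c") auto
        qed
        have fin: "finite U"
          using less.prems by (intro finite_subset[OF Uc]) auto
        have step: "(?f ^^ j) s \<in> lower_central G (i + j)" if "s \<in> S" for s j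
          using iterated_commutator_lower_central[OF xG] that less.prems by blast
        have Ui: "U \<subseteq> lower_central G i"
        proof
          fix u assume "u \<in> U"
          then obtain j s where js: "s \<in> S - {x}" "u = (?f ^^ j) s" by (auto simp: U_def)
          then show "u \<in> lower_central G i"
            using step[of s j] lower_central_mono[of i "i + j"] by auto
        qed
        \<comment> \<open>An iterate with \<open>j > 0\<close> has weight at least
          \<open>i + 1\<close>, so the elements of weight \<open>i\<close> in \<open>U\<close> are
          old elements of \<open>S\<close>, and \<open>x\<close> is no longer produced among
          them.\<close>
        have "U - lower_central G (Suc i) \<subseteq> S - {x} - lower_central G (Suc i)"
        proof
          fix u assume u: "u \<in> U - lower_central G (Suc i)"
          then obtain j s where js: "s \<in> S - {x}" "u = (?f ^^ j) s" by (auto simp: U_def)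
          have "j = 0"
          proof (rule ccontr)
            assume "j \<noteq> 0"
            then have "u \<in> lower_central G (Suc i)"
              using step[of s j] js lower_central_mono[of "Suc i" "i + j"] by auto
            then show False using u by blast
          qed
          then show "u \<in> S - {x} - lower_central G (Suc i)" using js u by simp
        qed
        also have "\<dots> \<subset> S - lower_central G (Suc i)"
          using x by blast
        finally have "card (U - lower_central G (Suc i)) < card (S - lower_central G (Suc i))"
          using less.prems by (intro psubset_card_mono) auto
        then have "P U" using less.hyps fin Ui by blast
        moreover have "S - {x} \<subseteq> U"
        proof
          fix s assume "s \<in> S - {x}"
          then have "(?f ^^ 0) s \<in> U" unfolding U_def by blast
          then show "s \<in> U" by simp
        qed
        moreover have "U \<subseteq> carrier G"
          using Ui lower_central_subset_carrier[of i] by blast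
        moreover have "U \<subseteq> generate G (insert x (S - {x}))"
        proof -
          have H: "subgroup (generate G (insert x (S - {x}))) G"
            using \<open>S - {x} \<subseteq> U\<close> \<open>U \<subseteq> carrier G\<close> xG by (intro generate_is_subgroup) auto
          have "(?f ^^ j) s \<in> generate G (insert x (S - {x}))" if "s \<in> S - {x}" for j s
          proof (induction j)
            case 0
            then show ?case using that by (auto intro: generate.incl)
          next
            case (Suc j)
            moreover have "x \<in> generate G (insert x (S - {x}))" by (auto intro: generate.incl)
            ultimately show ?case
              using subgroup.m_closed[OF H] subgroup.m_inv_closed[OF H]
              by (simp add: commutator_with_def del: insert_Diff_single)
          qed
          then show ?thesis by (auto simp: U_def)
        qed
        moreover have "?f t \<in> U" if "t \<in> U" for t
        proof -
          from that obtain j s where js: "s \<in> S - {x}" "t = (?f ^^ j) s" by (auto simp: U_def)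
          then have "?f t = (?f ^^ Suc j) s" by simp
          then show ?thesis unfolding U_def using js(1) by blast
        qed
        ultimately have "P (insert x (S - {x}))"
          using insert[of x U "S - {x}"] xG fin by blast
        then show ?thesis using x by (simp add: insert_absorb)
      qed
    qed
  qed
  show ?thesis using main[of 0] assms(2,3) by simp
qed

section \<open>Polynomial growth of nilpotent groups\<close>

text \<open>Conjugating \<open>t\<close> by \<open>x\<close> gives
  \<open>commutator_with G x t \<otimes> t\<close>. So the length for exponent \<open>Suc a\<close>
  and depth \<open>Suc k\<close> is at most the sum of the lengths for exponent \<open>a\<close> at
  depths \<open>k\<close> and \<open>Suc k\<close>, a Pascal-type recursion bounded by
  \<open>Suc a ^ k\<close>. The depth is the number of commutators with \<open>x\<close> that turn
  \<open>t\<close> into \<open>\<one>\<close>.\<close>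

lemma conj_pow_in_word_ball:
  assumes x: "x \<in> carrier G" and U: "U \<subseteq> carrier G"
    and cl: "\<forall>t\<in>U. commutator_with G x t \<in> U"
  shows "t \<in> U \<Longrightarrow> (commutator_with G x ^^ k) t = \<one> \<Longrightarrow>
    x [^] a \<otimes> t \<otimes> inv (x [^] (a::nat)) \<in> word_ball G U (Suc a ^ k)"
proof (induction k arbitrary: a t)
  case 0
  then show ?case using x word_ball_mono[OF U, of 0 1] by simp
next
  case (Suc k)
  note outer = Suc.IH and prems = Suc.prems
  have t: "t \<in> carrier G" "commutator_with G x t \<in> carrier G" using Suc.prems(1) U x by auto
  show ?case
  proof (induction a)
    case 0
    then show ?case using word_ball_incl[OF U prems(1), of 1] t by simp
  next
    case (Suc a)
    let ?y = "x [^] a"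
    have 1: "?y \<otimes> commutator_with G x t \<otimes> inv ?y \<in> word_ball G U (Suc a ^ k)"
      using prems cl by (intro outer) (auto simp: funpow_swap1)
    have "x [^] Suc a \<otimes> t \<otimes> inv (x [^] Suc a) = ?y \<otimes> (x \<otimes> t \<otimes> inv x) \<otimes> inv ?y"
      using x t by (simp add: inv_mult_group m_assoc)
    also have "\<dots> = (?y \<otimes> commutator_with G x t \<otimes> inv ?y) \<otimes> (?y \<otimes> t \<otimes> inv ?y)"
      using x t by (simp add: commutator_with_def m_assoc inv_cancel_left)
    also have "\<dots> \<in> word_ball G U (Suc a ^ k + Suc a ^ Suc k)"
      by (rule word_ball_mult[OF U 1 Suc.IH])
    also have "\<dots> \<subseteq> word_ball G U (Suc (Suc a) ^ Suc k)"
    proof (rule word_ball_mono[OF U])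
      have "Suc a ^ k + Suc a ^ Suc k = Suc (Suc a) * Suc a ^ k" by simp
      also have "\<dots> \<le> Suc (Suc a) * Suc (Suc a) ^ k"
        by (intro mult_left_mono power_mono) auto
      finally show "Suc a ^ k + Suc a ^ Suc k \<le> Suc (Suc a) ^ Suc k" by simp
    qed
    finally show ?case .
  qed
qed

text \<open>Collection: all letters \<open>x\<close> are moved to the right. A letter
  \<open>s\<close> met after \<open>a\<close> letters \<open>x\<close> is replaced by its conjugate
  by \<open>x [^] a\<close>, a word over \<open>U\<close> of length at most
  \<open>Suc a ^ c\<close>. The separate bound \<open>N\<close> keeps the cost per letter constant
  while \<open>n\<close> runs through the induction.\<close>

lemma word_ball_insert_subset:
  assumes nil: "lower_central G c = {\<one>}" and x: "x \<in> carrier G" and U: "U \<subseteq> carrier G" "S \<subseteq> U"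
    and cl: "\<forall>t\<in>U. commutator_with G x t \<in> U"
  shows "n \<le> N \<Longrightarrow> word_ball G (insert x S) n \<subseteq>
    (\<lambda>(w, a). w \<otimes> x [^] a) ` (word_ball G U (n * Suc N ^ c) \<times> {..n})"
proof (induction n)
  case 0
  show ?case by simp
next
  case (Suc n)
  let ?L = "Suc N ^ c" 
  show ?case
  proof
    fix g assume "g \<in> word_ball G (insert x S) (Suc n)"
    then obtain v s where vs: "v \<in> word_ball G (insert x S) n" "s = \<one> \<or> s = x \<or> s \<in> S" "g = v \<otimes> s"
      by (auto simp: set_mult_def)
    obtain w and a :: nat where w: "w \<in> word_ball G U (n * ?L)" "a \<le> n" "v = w \<otimes> x [^] a"
      using Suc vs(1) by fastforce
    have wG: "w \<in> carrier G" using w word_ball_subset_carrier[OF U(1)] by blast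
    have w': "w \<in> word_ball G U (Suc n * ?L)"
      using w(1) word_ball_mono[OF U(1), of "n * ?L" "Suc n * ?L"] by auto
    consider "s = \<one>" | "s = x" | "s \<in> S" using vs(2) by blast
    then have "\<exists>w a. w \<in> word_ball G U (Suc n * ?L) \<and> a \<le> Suc n \<and> g = w \<otimes> x [^] a"
    proof cases
      case 1
      then show ?thesis using w w' vs wG x by (intro exI[of _ w] exI[of _ a]) auto
    next
      case 2
      then show ?thesis using w w' vs wG x
        by (intro exI[of _ w] exI[of _ "Suc a"]) (auto simp: m_assoc)
    next
      case 3
      let ?u = "x [^] a \<otimes> s \<otimes> inv (x [^] a)"
      have sU: "s \<in> U" "s \<in> carrier G" using 3 U by auto
      have "?u \<in> word_ball G U (Suc a ^ c)"
        using iterated_commutator_eq_one[OF nil x sU(2)] sU(1)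
        by (intro conj_pow_in_word_ball[OF x U(1) cl]) auto
      also have "\<dots> \<subseteq> word_ball G U ?L"
        using w Suc.prems by (intro word_ball_mono[OF U(1)] power_mono) auto
      finally have "w \<otimes> ?u \<in> word_ball G U (n * ?L + ?L)"
        by (rule word_ball_mult[OF U(1) w(1)])
      moreover have "g = (w \<otimes> ?u) \<otimes> x [^] a"
        using vs w wG x sU by (simp add: m_assoc)
      ultimately show ?thesis using w(2)
        by (intro exI[of _ "w \<otimes> ?u"] exI[of _ a]) (auto simp: add.commute)
    qed
    then show "g \<in> (\<lambda>(w, a). w \<otimes> x [^] a) ` (word_ball G U (Suc n * ?L) \<times> {..Suc n})"
      by fastforce
  qed
qed

text \<open>After collection an element of the ball of radius \<open>n\<close> is given by a word
  over \<open>U\<close> of length polynomial in \<open>n\<close> and an exponent at most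
  \<open>n\<close>; composing polynomial bounds gives a polynomial bound.\<close>

lemma nilpotent_polynomial_growth:
  assumes "lower_central G c = {\<one>}" "finite S" "S \<subseteq> carrier G"
  shows "\<exists>D. \<forall>n. card (word_ball G S n) \<le> Suc n ^ D"
  using assms
proof (induction rule: nilpotent_finite_induct)
  case (trivial S)
  have "word_ball G S n \<subseteq> {\<one>}" for n
    by (induction n) (use trivial in \<open>force simp: set_mult_def\<close>)+
  then have "card (word_ball G S n) \<le> card {\<one>}" for n
    by (intro card_mono) auto
  then show ?case by (intro exI[of _ 0]) auto
next
  case (insert x S U)
  then obtain D where D: "\<And>n. card (word_ball G U n) \<le> Suc n ^ D" by blast
  \<comment> \<open>The word over \<open>U\<close> has length \<open>?m\<close> with
    \<open>Suc ?m \<le> Suc n ^ Suc c\<close>, whence the factor \<open>Suc c\<close> in the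
    exponent; the power of \<open>x\<close> contributes one more factor
    \<open>Suc n\<close>.\<close>
  have "card (word_ball G (Set.insert x S) n) \<le> Suc n ^ Suc (Suc c * D)" for n
  proof -
    let ?m = "n * Suc n ^ c"
    have "card (word_ball G (Set.insert x S) n) \<le> card (word_ball G U ?m \<times> {..n})"
      using word_ball_insert_subset[OF assms(1) insert(1,3,4,6), of n n] insert(2)
      by (intro surj_card_le finite_cartesian_product finite_word_ball) auto
    also have "\<dots> \<le> Suc ?m ^ D * Suc n"
      using D[of ?m] unfolding card_cartesian_product card_atMost by (rule mult_right_mono) simp
    also have "\<dots> \<le> (Suc n ^ Suc c) ^ D * Suc n"
      by (intro mult_right_mono power_mono) auto
    also have "\<dots> = Suc n ^ Suc (Suc c * D)"
      by (subst power_mult[symmetric]) (simp only: power_Suc mult.commute)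
    finally show ?thesis .
  qed
  then show ?case by blast
qed

end

section \<open>Residual finiteness\<close>

text \<open>For subgroups this says that \<open>H \<inter> K\<close> has finite index in
  \<open>H\<close>. Since \<open>K\<close> may reach outside \<open>H\<close>, one subgroup
  \<open>K\<close> can be measured against a whole chain of groups \<open>H\<close>.\<close>

definition finitely_covered :: "('a, 'b) monoid_scheme \<Rightarrow> 'a set \<Rightarrow> 'a set \<Rightarrow> bool" where
  "finitely_covered G H K \<longleftrightarrow> (\<exists>T. finite T \<and> T \<subseteq> carrier G \<and> H \<subseteq> T <#>\<^bsub>G\<^esub> K)"

context group
begin

lemma finitely_covered_refl:
  assumes "H \<subseteq> carrier G"
  shows "finitely_covered G H H"
  unfolding finitely_covered_def using assms
  by (intro exI[of _ "{\<one>}"]) (force simp: set_mult_def)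

lemma finitely_covered_mono:
  assumes "finitely_covered G H K" "K \<subseteq> L"
  shows "finitely_covered G H L"
  using assms mono_set_mult[OF subset_refl assms(2), of G]
  unfolding finitely_covered_def by (metis subset_trans)

lemma finitely_covered_trans:
  assumes "finitely_covered G H K" "finitely_covered G K L" "L \<subseteq> carrier G"
  shows "finitely_covered G H L"
proof -
  obtain T T' where T: "finite T" "T \<subseteq> carrier G" "H \<subseteq> T <#> K"
    and T': "finite T'" "T' \<subseteq> carrier G" "K \<subseteq> T' <#> L"
    using assms unfolding finitely_covered_def by blast
  have "T <#> K \<subseteq> (T <#> T') <#> L"
    using T T' assms(3) by (simp add: set_mult_assoc mono_set_mult)
  moreover have "finite (T <#> T')" "T <#> T' \<subseteq> carrier G"
    using T T' by (auto simp: set_mult_def)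
  ultimately show ?thesis
    using T(3) unfolding finitely_covered_def by blast
qed

text \<open>Among the \<open>card T + 1\<close> powers of \<open>g\<close> with exponents up to
  \<open>card T\<close>, two lie in the same coset of \<open>K\<close>, so some exponent between
  \<open>1\<close> and \<open>card T\<close> brings \<open>g\<close> into \<open>K\<close>. The
  factorial of \<open>card T\<close> is a multiple of all these exponents and hence works for every
  \<open>g\<close>.\<close>

lemma finitely_covered_power:
  assumes N: "subgroup N G" and K: "subgroup K G" and "finitely_covered G N K"
  obtains m :: nat where "0 < m" "\<And>g. g \<in> N \<Longrightarrow> g [^] m \<in> K"
proof -
  obtain T where T: "finite T" "T \<subseteq> carrier G" "N \<subseteq> T <#> K"
    using assms unfolding finitely_covered_def by blast
  have "g [^] (fact (card T) :: nat) \<in> K" if g: "g \<in> N" for g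
  proof -
  have gG: "g \<in> carrier G" using g subgroup.mem_carrier[OF N] by blast
  have "g [^] i \<in> N" for i :: nat
    using g subgroup_int_pow_closed[OF N, of g "int i"] by (simp add: int_pow_int)
  then have "\<exists>t. t \<in> T \<and> (\<exists>k\<in>K. g [^] i = t \<otimes> k)" for i :: nat
    using T(3) by (fastforce simp: set_mult_def)
  then obtain t where t: "\<And>i::nat. t i \<in> T" "\<And>i. \<exists>k\<in>K. g [^] i = t i \<otimes> k"
    by metis
  have "\<not> inj_on t {..card T}"
  proof
    assume "inj_on t {..card T}"
    then have "card {..card T} \<le> card T"
      using t(1) T(1) by (intro card_inj_on_le) auto
    then show False by simp
  qed
  then obtain i j where ij: "i < j" "j \<le> card T" "t i = t j"
    unfolding inj_on_def by (metis atMost_iff linorder_neqE_nat)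
  obtain k k' where k: "k \<in> K" "k' \<in> K" "g [^] i = t i \<otimes> k" "g [^] j = t i \<otimes> k'"
    using t(2)[of i] t(2)[of j] ij(3) by auto
  have kG: "k \<in> carrier G" "k' \<in> carrier G" "t i \<in> carrier G"
    using k subgroup.mem_carrier[OF K] t(1) T(2) by auto
  have "g [^] i \<otimes> g [^] (j - i) = g [^] j"
    using ij gG by (simp add: nat_pow_mult)
  then have "t i \<otimes> (k \<otimes> g [^] (j - i)) = t i \<otimes> k'"
    using k kG gG by (simp add: m_assoc)
  then have "k \<otimes> g [^] (j - i) = k'"
    using kG gG by simp
  then have "g [^] (j - i) = inv k \<otimes> k'"
    using kG gG inv_cancel_left(1)[of k "g [^] (j - i)"] by simp
  then have *: "g [^] (j - i) \<in> K"
    using k K by (simp add: subgroup.m_closed subgroup.m_inv_closed)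
  have "(j - i) dvd fact (card T)"
    using ij by (intro dvd_fact) auto
  then obtain q where "fact (card T) = (j - i) * q" by blast
  then have "g [^] (fact (card T) :: nat) = (g [^] (j - i)) [^] q"
    using gG by (simp add: nat_pow_pow)
  then show ?thesis
    using subgroup_int_pow_closed[OF K *, of "int q"] by (simp add: int_pow_int)
  qed
  then show thesis by (intro that[of "fact (card T)"]) auto
qed

section \<open>Normalised subgroups and their products with a cyclic group\<close>

lemma conj_nat_pow:
  assumes y: "y \<in> carrier G" and g: "g \<in> carrier G"
  shows "y \<otimes> g [^] (m::nat) \<otimes> inv y = (y \<otimes> g \<otimes> inv y) [^] m"
proof (induction m)
  case (Suc m)
  have "y \<otimes> g [^] Suc m \<otimes> inv y = (y \<otimes> g [^] m \<otimes> inv y) \<otimes> (y \<otimes> g \<otimes> inv y)"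
    using y g by (simp add: m_assoc inv_cancel_left)
  then show ?case by (simp add: Suc.IH)
qed (use y in simp)

lemma conj_generate:
  assumes y: "y \<in> carrier G" and U: "U \<subseteq> carrier G" and N: "subgroup N G"
    and cl: "\<And>u. u \<in> U \<Longrightarrow> y \<otimes> u \<otimes> inv y \<in> N"
    and n: "n \<in> generate G U"
  shows "y \<otimes> n \<otimes> inv y \<in> N"
  using n
proof induction
  case one
  then show ?case using y subgroup.one_closed[OF N] by simp
next
  case (incl h)
  then show ?case by (rule cl)
next
  case (inv h)
  then have "y \<otimes> inv h \<otimes> inv y = inv (y \<otimes> h \<otimes> inv y)"
    using y U by (auto simp: inv_mult_group m_assoc)
  then show ?case using subgroup.m_inv_closed[OF N cl[OF inv]] by simp
next
  case (eng a b)
  then have "a \<in> carrier G" "b \<in> carrier G" using generate_in_carrier[OF U] by auto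
  then have "y \<otimes> (a \<otimes> b) \<otimes> inv y = (y \<otimes> a \<otimes> inv y) \<otimes> (y \<otimes> b \<otimes> inv y)"
    using y by (simp add: m_assoc inv_cancel_left)
  then show ?case using subgroup.m_closed[OF N] eng.IH by simp
qed

text \<open>Both inclusions together give invariance under conjugation; one alone could map an
  infinite \<open>P\<close> properly into itself.\<close>

definition normalises :: "'a \<Rightarrow> 'a set \<Rightarrow> bool" where
  "normalises y P \<longleftrightarrow> (\<forall>p\<in>P. y \<otimes> p \<otimes> inv y \<in> P \<and> inv y \<otimes> p \<otimes> y \<in> P)"

lemma normalises_int_pow:
  assumes y: "y \<in> carrier G" and P: "P \<subseteq> carrier G" and norm: "normalises y P" and p: "p \<in> P"
  shows "y [^] (j::int) \<otimes> p \<otimes> inv (y [^] j) \<in> P"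
proof -
  \<comment> \<open>Stated for any \<open>z\<close>, so that it serves \<open>y\<close> for
    nonnegative and \<open>inv y\<close> for negative exponents.\<close>
  have nat: "z [^] n \<otimes> p \<otimes> inv (z [^] n) \<in> P"
    if z: "z \<in> carrier G" "\<And>p. p \<in> P \<Longrightarrow> z \<otimes> p \<otimes> inv z \<in> P" for z and n :: nat
  proof (induction n)
    case 0
    then show ?case using p P by (simp add: subset_iff)
  next
    case (Suc n)
    have "z \<otimes> (z [^] n \<otimes> p \<otimes> inv (z [^] n)) \<otimes> inv z \<in> P" by (rule z(2)[OF Suc])
    moreover have "z \<otimes> (z [^] n \<otimes> p \<otimes> inv (z [^] n)) \<otimes> inv z =
        z [^] Suc n \<otimes> p \<otimes> inv (z [^] Suc n)"
      using z(1) p P unfolding nat_pow_Suc2[OF z(1)] by (simp add: inv_mult_group m_assoc subset_iff)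
    ultimately show ?case by simp
  qed
  show ?thesis
  proof (cases j rule: int_cases)
    case (nonneg n)
    then show ?thesis using nat[of y n] y norm by (simp add: int_pow_int normalises_def)
  next
    case (neg n)
    then have "y [^] j = inv y [^] Suc n"
      using y nat_pow_inv[OF y, of "Suc n"] int_pow_neg_int[OF y, of "Suc n"] by simp
    then show ?thesis using nat[of "inv y" "Suc n"] y norm by (simp add: normalises_def)
  qed
qed

lemma normalises_int_pow':
  assumes "y \<in> carrier G" "P \<subseteq> carrier G" "normalises y P"
  shows "normalises (y [^] (j::int)) P"
  using normalises_int_pow[OF assms, of _ j] normalises_int_pow[OF assms, of _ "- j"] assms(1)
  by (simp add: normalises_def int_pow_neg)

text \<open>A power of \<open>y\<close> passes an element of \<open>P\<close> at the price of
  conjugating that element, which keeps it in \<open>P\<close>; so products and inverses can be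
  brought back to the form \<open>p \<otimes> y [^] j\<close>.\<close>

lemma subgroup_mult_cyclic:
  assumes P: "subgroup P G" and y: "y \<in> carrier G" and norm: "normalises y P"
  shows "subgroup {p \<otimes> y [^] (j::int) | p j. p \<in> P} G"
proof (rule subgroupI)
  note PG = subgroup.subset[OF P] subgroup.mem_carrier[OF P]
  note conj = normalises_int_pow[OF y PG(1) norm]
  show "{p \<otimes> y [^] (j::int) | p j. p \<in> P} \<subseteq> carrier G" using PG y by auto
  show "{p \<otimes> y [^] (j::int) | p j. p \<in> P} \<noteq> {}" using subgroup.one_closed[OF P] by blast
  fix a assume "a \<in> {p \<otimes> y [^] (j::int) | p j. p \<in> P}"
  then obtain p and j :: int where a: "p \<in> P" "a = p \<otimes> y [^] j" by blast
  have "inv a = (y [^] (- j) \<otimes> inv p \<otimes> inv (y [^] (- j))) \<otimes> y [^] (- j)"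
    using a PG y by (simp add: inv_mult_group m_assoc int_pow_neg)
  then show "inv a \<in> {p \<otimes> y [^] (j::int) | p j. p \<in> P}"
    using conj[of "inv p" "- j"] subgroup.m_inv_closed[OF P a(1)] by blast
  fix b assume "b \<in> {p \<otimes> y [^] (j::int) | p j. p \<in> P}"
  then obtain q and i :: int where b: "q \<in> P" "b = q \<otimes> y [^] i" by blast
  have "a \<otimes> b = (p \<otimes> (y [^] j \<otimes> q \<otimes> inv (y [^] j))) \<otimes> y [^] (j + i)"
    using a b PG y by (simp add: m_assoc int_pow_mult inv_cancel_left)
  then show "a \<otimes> b \<in> {p \<otimes> y [^] (j::int) | p j. p \<in> P}"
    using subgroup.m_closed[OF P a(1) conj[OF b(1)]] by blast
qed

text \<open>Write \<open>j = a + q * b\<close> with \<open>0 \<le> a < q\<close>. Moving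
  \<open>x [^] a\<close> to the left conjugates \<open>n\<close> inside \<open>N\<close>, where
  \<open>T\<close> represents the cosets of \<open>K\<close>, and the remaining factor
  \<open>x [^] (q * b)\<close> lies in \<open>K\<close>. So the products
  \<open>x [^] a \<otimes> t\<close> represent all cosets that occur.\<close>

lemma finitely_covered_mult_cyclic:
  assumes N: "N \<subseteq> carrier G" and x: "x \<in> carrier G" and norm: "normalises x N"
    and K: "subgroup K G" and cov: "finitely_covered G N K" and q: "0 < (q::nat)" "x [^] q \<in> K"
  shows "finitely_covered G {n \<otimes> x [^] (j::int) | n j. n \<in> N} K"
proof -
  obtain T where T: "finite T" "T \<subseteq> carrier G" "N \<subseteq> T <#> K"
    using cov unfolding finitely_covered_def by blast
  let ?T = "([^]) x ` {0..<int q} <#> T"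
  have "{n \<otimes> x [^] (j::int) | n j. n \<in> N} \<subseteq> ?T <#> K"
  proof clarify
    fix n and j :: int assume n: "n \<in> N"
    define a where "a = j mod int q"
    define b where "b = j div int q"
    have j: "j = a + int q * b" by (simp add: a_def b_def)
    have "x [^] (- a) \<otimes> n \<otimes> inv (x [^] (- a)) \<in> N"
      by (rule normalises_int_pow[OF x N norm n])
    then obtain t k where tk: "t \<in> T" "k \<in> K" "x [^] (- a) \<otimes> n \<otimes> inv (x [^] (- a)) = t \<otimes> k"
      using T(3) by (force simp: set_mult_def)
    have G: "t \<in> carrier G" "k \<in> carrier G" "n \<in> carrier G"
      using tk T subgroup.mem_carrier[OF K] n N by auto
    have "x [^] j = x [^] a \<otimes> x [^] (int q * b)"
      by (simp add: j int_pow_mult x)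
    then have "n \<otimes> x [^] j = x [^] a \<otimes> (x [^] (- a) \<otimes> n \<otimes> inv (x [^] (- a))) \<otimes> x [^] (int q * b)"
      using x G by (simp add: int_pow_neg m_assoc inv_cancel_left)
    also have "\<dots> = (x [^] a \<otimes> t) \<otimes> (k \<otimes> x [^] (int q * b))"
      unfolding tk(3) using x G by (simp add: m_assoc)
    finally have eq: "n \<otimes> x [^] j = (x [^] a \<otimes> t) \<otimes> (k \<otimes> x [^] (int q * b))" .
    have "x [^] (int q * b) = (x [^] q) [^] b"
      using x by (simp add: int_pow_pow flip: int_pow_int)
    then have "k \<otimes> x [^] (int q * b) \<in> K"
      using subgroup_int_pow_closed[OF K q(2)] subgroup.m_closed[OF K tk(2)] by simp
    moreover have "x [^] a \<otimes> t \<in> ?T"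
      using tk(1) q(1) by (auto simp: set_mult_def a_def)
    ultimately show "n \<otimes> x [^] j \<in> ?T <#> K"
      unfolding eq set_mult_def by blast
  qed
  moreover have "finite ?T" "?T \<subseteq> carrier G"
    using T x by (auto simp: set_mult_def)
  ultimately show ?thesis
    unfolding finitely_covered_def by blast
qed

text \<open>The splitting step: with \<open>N = generate G U\<close>, closure of \<open>U\<close>
  under commutators with \<open>x\<close> makes \<open>N\<close> invariant under \<open>x\<close>,
  and nilpotency makes it invariant under \<open>inv x\<close>. Then the products of
  \<open>N\<close> with powers of \<open>x\<close> form a subgroup that contains the
  generators.\<close>

lemma nilpotent_generate_insert:
  assumes nil: "lower_central G c = {\<one>}" and x: "x \<in> carrier G" and U: "U \<subseteq> carrier G" "S \<subseteq> U"
    and gen: "U \<subseteq> generate G (insert x S)"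
    and cl: "\<forall>t\<in>U. commutator_with G x t \<in> U"
  shows "normalises x (generate G U)"
    and "generate G (insert x S) = {n \<otimes> x [^] (j::int) | n j. n \<in> generate G U}"
    and "generate G U \<subseteq> generate G (insert x S)"
proof -
  have N: "subgroup (generate G U) G" using U by (simp add: generate_is_subgroup)
  have ix: "inv x \<in> carrier G" using x by simp
  have 1: "x \<otimes> u \<otimes> inv x \<in> generate G U" if "u \<in> U" for u
  proof -
    have "commutator_with G x u \<in> generate G U" "u \<in> generate G U"
      using that cl by (auto intro: generate.incl)
    then show ?thesis using that U x by (simp add: conj_eq_commutator generate.eng subset_iff)
  qed
  \<comment> \<open>Conjugation by \<open>inv x\<close> sends \<open>u\<close> to
    \<open>inv (inv x \<otimes> ?v \<otimes> x) \<otimes> u\<close>, where \<open>?v\<close> is the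
    commutator of \<open>x\<close> and \<open>u\<close>. As \<open>?v\<close> has smaller depth,
    induction on the depth \<open>k\<close> applies.\<close>
  have 2: "inv x \<otimes> u \<otimes> x \<in> generate G U" if "u \<in> U" "(commutator_with G x ^^ k) u = \<one>" for u k
    using that
  proof (induction k arbitrary: u)
    case 0
    then show ?case using x by (auto intro: generate.one)
  next
    case (Suc k)
    let ?v = "commutator_with G x u"
    have G: "u \<in> carrier G" "?v \<in> carrier G" using Suc.prems U x by auto
    have v: "inv x \<otimes> ?v \<otimes> x \<in> generate G U"
      using Suc.prems cl by (intro Suc.IH) (auto simp: funpow_swap1)
    have "u = (inv x \<otimes> ?v \<otimes> x) \<otimes> (inv x \<otimes> u \<otimes> x)"
      using x G by (simp add: commutator_with_def m_assoc inv_cancel_left)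
    then have "inv x \<otimes> u \<otimes> x = inv (inv x \<otimes> ?v \<otimes> x) \<otimes> u"
      using x G by (metis inv_cancel_left(1) m_closed ix)
    then show ?case
      using v Suc.prems subgroup.m_closed[OF N] subgroup.m_inv_closed[OF N] generate.incl by metis
  qed
  have 3: "inv x \<otimes> u \<otimes> inv (inv x) \<in> generate G U" if "u \<in> U" for u
    using 2[OF that, of c] iterated_commutator_eq_one[OF nil x, of u c] that U x by auto
  show norm: "normalises x (generate G U)"
    unfolding normalises_def
    using conj_generate[OF x U(1) N 1] conj_generate[OF ix U(1) N 3] x by auto
  have H: "subgroup (generate G (insert x S)) G"
    using x U by (intro generate_is_subgroup) auto
  show sub: "generate G U \<subseteq> generate G (insert x S)"
    by (rule generate_subgroup_incl[OF gen H])
  show "generate G (insert x S) = {n \<otimes> x [^] (j::int) | n j. n \<in> generate G U}"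
  proof
    have "x = \<one> \<otimes> x [^] (1::int)" using x by simp
    moreover have "s = s \<otimes> x [^] (0::int)" if "s \<in> S" for s using that U by auto
    ultimately have "insert x S \<subseteq> {n \<otimes> x [^] (j::int) | n j. n \<in> generate G U}"
      using U generate.one[of G U] generate.incl[of _ U G] by blast
    then show "generate G (insert x S) \<subseteq> {n \<otimes> x [^] (j::int) | n j. n \<in> generate G U}"
      by (rule generate_subgroup_incl[OF _ subgroup_mult_cyclic[OF N x norm]])
    show "{n \<otimes> x [^] (j::int) | n j. n \<in> generate G U} \<subseteq> generate G (insert x S)"
    proof clarify
      fix n and j :: int assume "n \<in> generate G U"
      moreover have "x [^] j \<in> generate G (insert x S)"
        by (intro subgroup_int_pow_closed[OF H] generate.incl) simp
      ultimately show "n \<otimes> x [^] j \<in> generate G (insert x S)"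
        using sub subgroup.m_closed[OF H] by blast
    qed
  qed
qed

text \<open>A finitely generated nilpotent group of finite exponent is finite; this is the
  corresponding statement for cosets. Each split-off generator \<open>x\<close> satisfies
  \<open>x [^] m \<in> K\<close> and so multiplies the number of representatives by at most
  \<open>m\<close>.\<close>

lemma nilpotent_finitely_covered_if_powers:
  assumes "lower_central G c = {\<one>}" "finite S" "S \<subseteq> carrier G"
    and "subgroup K G" "0 < (m::nat)" "\<And>g. g \<in> generate G S \<Longrightarrow> g [^] m \<in> K"
  shows "finitely_covered G (generate G S) K"
  using assms
proof (induction rule: nilpotent_finite_induct)
  case (trivial S)
  then have "generate G S \<subseteq> K"
    using generate_one mono_generate[of S "{\<one>}"] subgroup.one_closed[OF \<open>subgroup K G\<close>] by auto
  then show ?case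
    using finitely_covered_mono[OF finitely_covered_refl] generate_incl trivial(1) one_closed
    by (metis empty_subsetI insert_subset subset_trans)
next
  case (insert x S U)
  note N = nilpotent_generate_insert[OF assms(1) insert(1,3,4,5,6)]
  have "finitely_covered G (generate G U) K"
    using insert.IH insert.prems N(3) by blast
  moreover have "x [^] m \<in> K"
    using insert generate.incl[of x "Set.insert x S" G] by auto
  ultimately show ?case
    unfolding N(2) using insert N(1) generate_incl[of U]
    by (intro finitely_covered_mult_cyclic[where q = m]) auto
qed

text \<open>Split the group as \<open>?N\<close> times the powers of \<open>x\<close>. If a positive
  power of \<open>x\<close> lies in \<open>?N\<close>, then \<open>?N\<close> has finite index and
  either \<open>?N\<close> or a subgroup from the induction separates \<open>g\<close>. Otherwise
  the exponent of \<open>x\<close> is well defined: a nonzero exponent is detected modulo a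
  multiple, and an element of \<open>?N\<close> is separated by a subgroup that contains
  \<open>x\<close>.\<close>

lemma nilpotent_residually_finite:
  assumes "lower_central G c = {\<one>}" "finite S" "S \<subseteq> carrier G"
    and "g \<in> generate G S" "g \<noteq> \<one>"
  shows "\<exists>K. subgroup K G \<and> finitely_covered G (generate G S) K \<and> g \<notin> K"
  using assms
proof (induction arbitrary: g rule: nilpotent_finite_induct)
  case (trivial S)
  then show ?case using generate_one mono_generate[of S "{\<one>}"] by auto
next
  case (insert x S U)
  let ?N = "generate G U"
  note N = nilpotent_generate_insert[OF assms(1) insert(1,3,4,5,6)]
  have NG: "subgroup ?N G" "?N \<subseteq> carrier G"
    using insert by (auto simp: generate_is_subgroup generate_incl)
  note cov = finitely_covered_mult_cyclic[OF NG(2) insert(1) N(1), folded N(2)]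
  \<comment> \<open>The exponent \<open>m\<close> is added because \<open>K\<close> alone gives no
    control over powers of \<open>x\<close> or over conjugation by \<open>x\<close>.\<close>
  have IH: "\<exists>K m. subgroup K G \<and> finitely_covered G ?N K \<and> g \<notin> K \<and> 0 < m \<and> (\<forall>n\<in>?N. n [^] (m::nat) \<in> K)"
    if gN: "g \<in> ?N"
  proof -
    obtain K where K: "subgroup K G" "finitely_covered G ?N K" "g \<notin> K"
      using insert.IH[OF gN] insert.prems by blast
    then show ?thesis using finitely_covered_power[OF NG(1) K(1,2)] by metis
  qed
  have xG: "x \<in> carrier G" by fact
  show ?case
  proof (cases "\<exists>r>0. x [^] (r::nat) \<in> ?N")
    case True
    then obtain r :: nat where r: "0 < r" "x [^] r \<in> ?N" by blast
    show ?thesis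
    proof (cases "g \<in> ?N")
      case True
      then obtain K m where K: "subgroup K G" "finitely_covered G ?N K" "g \<notin> K" "0 < m"
        "\<forall>n\<in>?N. n [^] (m::nat) \<in> K" using IH by blast
      \<comment> \<open>The element \<open>x [^] r\<close> lies in \<open>?N\<close>, so its
        \<open>m\<close>-th power lies in \<open>K\<close>.\<close>
      then have "x [^] (r * m) \<in> K" using r(2) xG by (simp flip: nat_pow_pow)
      then show ?thesis using cov[OF K(1,2), of "r * m"] r(1) K by auto
    next
      case False
      \<comment> \<open>Here \<open>?N\<close> itself avoids \<open>g\<close>, and
        \<open>x [^] r \<in> ?N\<close> gives it finite index.\<close>
      then show ?thesis
        using cov[OF NG(1) finitely_covered_refl[OF NG(2)] r] NG by blast
    qed
  next
    case False
    \<comment> \<open>This makes the exponent \<open>j\<close> in \<open>n \<otimes> x [^] j\<close>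
      unique.\<close>
    have zero: "j = 0" if "x [^] (j::int) \<in> ?N" for j
    proof (rule ccontr)
      assume "j \<noteq> 0"
      have "x [^] (- j) \<in> ?N" using that xG NG(1) by (simp add: int_pow_neg subgroup.m_inv_closed)
      then have "x [^] \<bar>j\<bar> \<in> ?N" using that by (simp add: abs_if)
      then have "x [^] nat \<bar>j\<bar> \<in> ?N" by (simp add: pow_nat)
      moreover have "0 < nat \<bar>j\<bar>" using \<open>j \<noteq> 0\<close> by simp
      ultimately show False using False by blast
    qed
    obtain n and k :: int where g: "n \<in> ?N" "g = n \<otimes> x [^] k"
      using insert.prems unfolding N(2) by blast
    have nG: "n \<in> carrier G" using g NG by blast
    show ?thesis
    proof (cases "k = 0")
      case False
      \<comment> \<open>The nonzero \<open>k\<close> is not a multiple of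
        \<open>2 * \<bar>k\<bar>\<close>. So \<open>g\<close>, whose exponent is \<open>k\<close>,
        is not in \<open>?K\<close>, whose exponents are multiples of \<open>q\<close>.\<close>
      define q where "q = 2 * nat \<bar>k\<bar>"
      let ?y = "x [^] int q"
      let ?K = "{p \<otimes> ?y [^] (j::int) | p j. p \<in> ?N}"
      have K: "subgroup ?K G"
        using xG by (intro subgroup_mult_cyclic[OF NG(1)] normalises_int_pow' NG N) auto
      have "n \<in> ?K" if "n \<in> ?N" for n
        using that NG xG by (intro CollectI exI[of _ n] exI[of _ 0]) auto
      then have "finitely_covered G ?N ?K"
        by (intro finitely_covered_mono[OF finitely_covered_refl[OF NG(2)]]) blast
      moreover have "x [^] q \<in> ?K"
        using xG generate.one[of G U]
        by (intro CollectI exI[of _ \<one>] exI[of _ 1]) (auto simp: int_pow_int)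
      moreover have "0 < q" using False by (simp add: q_def)
      moreover have "g \<notin> ?K"
      proof
        assume "g \<in> ?K"
        then obtain p and j :: int where p: "p \<in> ?N" "g = p \<otimes> ?y [^] j" by blast
        have pG: "p \<in> carrier G" using p NG by blast
        have "n \<otimes> x [^] k = p \<otimes> x [^] (int q * j)"
          using p g xG by (simp add: int_pow_pow)
        then have "inv p \<otimes> n \<otimes> x [^] k = x [^] (int q * j)"
          using pG nG xG by (simp add: m_assoc inv_cancel_left)
        then have "inv p \<otimes> n = x [^] (int q * j - k)"
          using pG nG xG by (simp add: int_pow_diff inv_solve_right)
        then have "x [^] (int q * j - k) \<in> ?N"
          using p(1) g(1) NG(1) by (metis subgroup.m_closed subgroup.m_inv_closed)
        then have "k = int q * j" using zero by fastforce
        then have "\<bar>k\<bar> = \<bar>int q * j\<bar>" by (rule arg_cong)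
        also have "\<dots> = \<bar>k\<bar> * (2 * \<bar>j\<bar>)" by (simp add: q_def abs_mult)
        finally have "2 * \<bar>j\<bar> = 1" using False by simp
        then show False by presburger
      qed
      ultimately show ?thesis using cov[OF K] K by blast
    next
      case True
      then have gN: "g \<in> ?N" using g nG by simp
      then obtain K0 m where K0: "subgroup K0 G" "g \<notin> K0" "0 < m" "\<forall>n\<in>?N. n [^] (m::nat) \<in> K0"
        using IH by blast
      \<comment> \<open>A finite index subgroup of \<open>N\<close> avoiding \<open>g\<close> need not be normalised by \<open>x\<close>, but the subgroup
        generated by the \<open>m\<close>-th powers in \<open>N\<close> is.\<close>
      let ?V = "(\<lambda>n. n [^] m) ` ?N"
      let ?P = "generate G ?V"
      let ?K = "{p \<otimes> x [^] (j::int) | p j. p \<in> ?P}"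
      have VN: "?V \<subseteq> ?N"
        using subgroup_int_pow_closed[OF NG(1), of _ "int m"] by (auto simp: int_pow_int)
      then have V: "?V \<subseteq> carrier G" using NG by blast
      have P: "subgroup ?P G" using V by (rule generate_is_subgroup)
      have PN: "?P \<subseteq> ?N" using VN NG by (intro generate_subgroup_incl)
      have PK0: "?P \<subseteq> K0" using K0 by (intro generate_subgroup_incl) auto
      have conj: "y \<otimes> p \<otimes> inv y \<in> ?P"
        if y: "y \<in> carrier G" "\<And>n. n \<in> ?N \<Longrightarrow> y \<otimes> n \<otimes> inv y \<in> ?N" and p: "p \<in> ?P" for y p
      proof (rule conj_generate[OF y(1) V P _ p])
        fix u assume "u \<in> ?V"
        then obtain n where n: "n \<in> ?N" "u = n [^] m" by blast
        have "y \<otimes> n [^] m \<otimes> inv y = (y \<otimes> n \<otimes> inv y) [^] m"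
          using y(1) n(1) NG(2) by (intro conj_nat_pow) auto
        then show "y \<otimes> u \<otimes> inv y \<in> ?P" using y(2)[OF n(1)] n(2) by (auto intro: generate.incl)
      qed
      have norm: "normalises x ?P"
        unfolding normalises_def
        using conj[of x] conj[of "inv x"] N(1) xG by (auto simp: normalises_def)
      have K: "subgroup ?K G" by (rule subgroup_mult_cyclic[OF P xG norm])
      have PK: "p \<in> ?K" if "p \<in> ?P" for p
        using that subgroup.mem_carrier[OF P that] xG
        by (intro CollectI exI[of _ p] exI[of _ 0]) auto
      \<comment> \<open>All \<open>m\<close>-th powers of \<open>?N\<close> lie in \<open>?P\<close>
        and hence in \<open>?K\<close>.\<close>
      have "finitely_covered G ?N ?K"
        by (rule nilpotent_finitely_covered_if_powers[OF assms(1) insert(2,3) K K0(3)])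
          (rule PK, rule generate.incl, rule imageI)
      moreover have "x [^] (1::nat) \<in> ?K"
        using xG generate.one[of G ?V]
        by (intro CollectI exI[of _ \<one>] exI[of _ 1]) (auto simp: int_pow_int)
      moreover have "g \<notin> ?K"
      proof
        assume "g \<in> ?K"
        then obtain p and j :: int where p: "p \<in> ?P" "g = p \<otimes> x [^] j" by blast
        have pG: "p \<in> carrier G" using subgroup.mem_carrier[OF P p(1)] .
        have "x [^] j = inv p \<otimes> g"
          using p pG xG by (simp add: inv_cancel_left)
        \<comment> \<open>Uniqueness of the exponent forces \<open>j = 0\<close>, so adjoining
          \<open>x\<close> to \<open>?P\<close> adds no element of \<open>?N\<close>, and
          \<open>?P\<close> avoids \<open>g\<close> because \<open>K0\<close> does.\<close>
        then have "x [^] j \<in> ?N"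
          using p(1) PN gN NG(1) by (metis subgroup.m_closed subgroup.m_inv_closed subset_iff)
        then have "g = p" using zero[of j] p pG by simp
        then show False using p PK0 K0 by blast
      qed
      ultimately show ?thesis using cov[OF K _ zero_less_one] K by blast
    qed
  qed
qed

section \<open>Finite index subgroups and regular approximations\<close>

lemma finite_index_iff_finitely_covered:
  assumes K: "subgroup K G"
  shows "finite_index_subgroup K G \<longleftrightarrow> finitely_covered G (carrier G) K"
proof
  assume "finite_index_subgroup K G"
  then have "finite (lcosets K)" by (simp add: finite_index_subgroup_def)
  moreover have "lcosets K = (\<lambda>a. a <# K) ` carrier G" by (auto simp: LCOSETS_def)
  ultimately obtain T where T: "finite T" "T \<subseteq> carrier G" "lcosets K = (\<lambda>a. a <# K) ` T"
    by (metis finite_subset_image order_refl)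
  have "carrier G = \<Union> (lcosets K)" using lcosets_part_G[OF K] by simp
  also have "\<dots> = T <#> K" unfolding T(3) by (auto simp: l_coset_def set_mult_def)
  finally show "finitely_covered G (carrier G) K"
    unfolding finitely_covered_def using T by blast
next
  assume "finitely_covered G (carrier G) K"
  then obtain T where T: "finite T" "T \<subseteq> carrier G" "carrier G \<subseteq> T <#> K"
    unfolding finitely_covered_def by blast
  have "lcosets K \<subseteq> (\<lambda>t. t <# K) ` T"
  proof
    fix X assume "X \<in> lcosets K"
    then obtain a where a: "a \<in> carrier G" "X = a <# K" by (auto simp: LCOSETS_def)
    then obtain t k where t: "t \<in> T" "k \<in> K" "a = t \<otimes> k" using T(3) by (auto simp: set_mult_def)
    then have "a \<in> t <# K" by (auto simp: l_coset_def)
    then have "t <# K = a <# K" using l_repr_independence[OF _ _ K] t(1) T(2) by blast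
    then show "X \<in> (\<lambda>t. t <# K) ` T" using a t by blast
  qed
  then show "finite_index_subgroup K G"
    unfolding finite_index_subgroup_def using K finite_imageI[OF T(1)] by (auto intro: finite_subset)
qed

lemma finite_index_subgroup_carrier: "finite_index_subgroup (carrier G) G"
  by (simp add: finite_index_iff_finitely_covered subgroup_self finitely_covered_refl)

text \<open>A nonempty intersection of a coset of \<open>A\<close> with a coset of \<open>B\<close>
  is a single coset of \<open>A \<inter> B\<close>, and there are finitely many pairs of
  cosets.\<close>

lemma finite_index_subgroup_Int:
  assumes "finite_index_subgroup A G" "finite_index_subgroup B G"
  shows "finite_index_subgroup (A \<inter> B) G"
proof -
  have AB: "subgroup A G" "subgroup B G"
    using assms by (auto simp: finite_index_subgroup_def)
  then have I: "subgroup (A \<inter> B) G" by (rule subgroups_Inter_pair)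
  obtain S T where S: "finite S" "S \<subseteq> carrier G" "carrier G \<subseteq> S <#> A"
    and T: "finite T" "T \<subseteq> carrier G" "carrier G \<subseteq> T <#> B"
    using assms AB unfolding finite_index_iff_finitely_covered[OF AB(1)]
      finite_index_iff_finitely_covered[OF AB(2)] finitely_covered_def by blast
  \<comment> \<open>For a pair with empty intersection the choice is arbitrary; intersecting with
    \<open>carrier G\<close> in \<open>R\<close> discards values outside the group.\<close>
  define r where "r = (\<lambda>(s, t). SOME g. g \<in> (s <# A) \<inter> (t <# B))"
  define R where "R = r ` (S \<times> T) \<inter> carrier G"
  have "carrier G \<subseteq> R <#> (A \<inter> B)"
  proof
    fix g assume g: "g \<in> carrier G"
    obtain s a where s: "s \<in> S" "a \<in> A" "g = s \<otimes> a" using g S by (auto simp: set_mult_def)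
    obtain t b where t: "t \<in> T" "b \<in> B" "g = t \<otimes> b" using g T by (auto simp: set_mult_def)
    have "g \<in> s <# A" using s by (auto simp: l_coset_def)
    moreover have "g \<in> t <# B" using t by (auto simp: l_coset_def)
    ultimately have "g \<in> (s <# A) \<inter> (t <# B)" by blast
    then have "r (s, t) \<in> (s <# A) \<inter> (t <# B)" unfolding r_def split_conv by (rule someI)
    then obtain a' b' where r: "a' \<in> A" "b' \<in> B" "r (s, t) = s \<otimes> a'" "r (s, t) = t \<otimes> b'"
      by (auto simp: l_coset_def)
    have G: "s \<in> carrier G" "t \<in> carrier G" "a \<in> carrier G" "b \<in> carrier G" "a' \<in> carrier G" "b' \<in> carrier G"
      using s t r S T subgroup.mem_carrier[OF AB(1)] subgroup.mem_carrier[OF AB(2)] by auto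
    have rG: "r (s, t) \<in> carrier G" using r G by simp
    have "inv (r (s, t)) \<otimes> g = inv a' \<otimes> a"
      unfolding r(3) s(3) using G by (simp add: inv_mult_group m_assoc inv_cancel_left)
    moreover have "inv (r (s, t)) \<otimes> g = inv b' \<otimes> b"
      unfolding r(4) t(3) using G by (simp add: inv_mult_group m_assoc inv_cancel_left)
    ultimately have "inv (r (s, t)) \<otimes> g \<in> A \<inter> B"
      using s t r AB by (metis IntI subgroup.m_closed subgroup.m_inv_closed)
    moreover have "g = r (s, t) \<otimes> (inv (r (s, t)) \<otimes> g)" using rG g by (simp add: inv_cancel_left)
    moreover have "r (s, t) \<in> R" using s t rG by (auto simp: R_def)
    ultimately show "g \<in> R <#> (A \<inter> B)" unfolding set_mult_def by blast
  qed
  moreover have "finite R" "R \<subseteq> carrier G" using S T by (auto simp: R_def)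
  ultimately show ?thesis
    unfolding finite_index_iff_finitely_covered[OF I] finitely_covered_def by blast
qed

section \<open>Normal cores of finite index subgroups\<close>

lemma subgroup_conjugates:
  assumes K: "subgroup K G" and F: "F \<subseteq> carrier G"
  shows "subgroup {g \<in> carrier G. \<forall>a\<in>F. inv a \<otimes> g \<otimes> a \<in> K} G"
proof (rule subgroupI)
  show "{g \<in> carrier G. \<forall>a\<in>F. inv a \<otimes> g \<otimes> a \<in> K} \<noteq> {}"
    using F subgroup.one_closed[OF K] by (auto intro!: exI[of _ \<one>] simp: subset_iff)
  fix g assume g: "g \<in> {g \<in> carrier G. \<forall>a\<in>F. inv a \<otimes> g \<otimes> a \<in> K}"
  have "inv a \<otimes> inv g \<otimes> a = inv (inv a \<otimes> g \<otimes> a)" if "a \<in> F" for a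
    using that g F by (simp add: inv_mult_group m_assoc subset_iff)
  then show "inv g \<in> {g \<in> carrier G. \<forall>a\<in>F. inv a \<otimes> g \<otimes> a \<in> K}"
    using g subgroup.m_inv_closed[OF K] by auto
  fix h assume h: "h \<in> {g \<in> carrier G. \<forall>a\<in>F. inv a \<otimes> g \<otimes> a \<in> K}"
  have "inv a \<otimes> (g \<otimes> h) \<otimes> a = (inv a \<otimes> g \<otimes> a) \<otimes> (inv a \<otimes> h \<otimes> a)" if "a \<in> F" for a
    using that g h F by (simp add: m_assoc inv_cancel_left subset_iff)
  then show "g \<otimes> h \<in> {g \<in> carrier G. \<forall>a\<in>F. inv a \<otimes> g \<otimes> a \<in> K}"
    using g h subgroup.m_closed[OF K] by auto
qed auto

text \<open>The set is the intersection of the conjugates of \<open>K\<close> by the elements of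
  \<open>F\<close>. A conjugate by \<open>b\<close> has finite index:
  \<open>g \<otimes> b = t \<otimes> k\<close> rewrites as \<open>g = (t \<otimes> inv b) \<otimes>
  (b \<otimes> k \<otimes> inv b)\<close>.\<close>

lemma finite_index_conjugates:
  assumes K: "finite_index_subgroup K G" and "finite F" "F \<subseteq> carrier G"
  shows "finite_index_subgroup {g \<in> carrier G. \<forall>a\<in>F. inv a \<otimes> g \<otimes> a \<in> K} G"
  using assms(2,3)
proof (induction F)
  case empty
  then show ?case by (simp add: finite_index_subgroup_carrier)
next
  case (insert b F)
  have Ks: "subgroup K G" using K by (simp add: finite_index_subgroup_def)
  let ?B = "{g \<in> carrier G. \<forall>a\<in>{b}. inv a \<otimes> g \<otimes> a \<in> K}"
  have B: "subgroup ?B G" using insert.prems by (intro subgroup_conjugates[OF Ks]) auto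
  obtain T where T: "finite T" "T \<subseteq> carrier G" "carrier G \<subseteq> T <#> K"
    using K unfolding finite_index_iff_finitely_covered[OF Ks] finitely_covered_def by blast
  have "carrier G \<subseteq> (\<lambda>t. t \<otimes> inv b) ` T <#> ?B"
  proof
    fix g assume g: "g \<in> carrier G"
    have b: "b \<in> carrier G" using insert.prems by simp
    have "g \<otimes> b \<in> T <#> K" using g b T(3) by blast
    then obtain t k where t: "t \<in> T" "k \<in> K" "g \<otimes> b = t \<otimes> k"
      by (auto simp: set_mult_def)
    have tG: "t \<in> carrier G" "k \<in> carrier G" using t T subgroup.mem_carrier[OF Ks] by auto
    have "g = (g \<otimes> b) \<otimes> inv b" using g b by (simp add: m_assoc)
    also have "\<dots> = (t \<otimes> inv b) \<otimes> (b \<otimes> k \<otimes> inv b)"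
      unfolding t(3) using b tG by (simp add: m_assoc inv_cancel_left)
    finally have "g = (t \<otimes> inv b) \<otimes> (b \<otimes> k \<otimes> inv b)" .
    moreover have "b \<otimes> k \<otimes> inv b \<in> ?B"
      using b tG t(2) by (simp add: m_assoc inv_cancel_left)
    ultimately show "g \<in> (\<lambda>t. t \<otimes> inv b) ` T <#> ?B" using t(1) unfolding set_mult_def by blast
  qed
  moreover have "finite ((\<lambda>t. t \<otimes> inv b) ` T)" "(\<lambda>t. t \<otimes> inv b) ` T \<subseteq> carrier G"
    using T insert.prems by auto
  ultimately have "finite_index_subgroup ?B G"
    unfolding finite_index_iff_finitely_covered[OF B] finitely_covered_def by blast
  then have "finite_index_subgroup (?B \<inter> {g \<in> carrier G. \<forall>a\<in>F. inv a \<otimes> g \<otimes> a \<in> K}) G"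
    using insert by (intro finite_index_subgroup_Int) auto
  moreover have "?B \<inter> {g \<in> carrier G. \<forall>a\<in>F. inv a \<otimes> g \<otimes> a \<in> K} =
      {g \<in> carrier G. \<forall>a\<in>Set.insert b F. inv a \<otimes> g \<otimes> a \<in> K}" by auto
  ultimately show ?case by simp
qed

text \<open>The core is the intersection of all conjugates of \<open>K\<close>. The conjugate by
  \<open>t \<otimes> k\<close> with \<open>k \<in> K\<close> equals the conjugate by
  \<open>t\<close>, so only finitely many conjugates occur.\<close>

lemma finite_index_normal_core:
  assumes K: "finite_index_subgroup K G"
  obtains N where "finite_index_subgroup N G" "N \<lhd> G" "N \<subseteq> K"
proof
  let ?N = "{g \<in> carrier G. \<forall>a\<in>carrier G. inv a \<otimes> g \<otimes> a \<in> K}"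
  have Ks: "subgroup K G" using K by (simp add: finite_index_subgroup_def)
  obtain T where T: "finite T" "T \<subseteq> carrier G" "carrier G \<subseteq> T <#> K"
    using K unfolding finite_index_iff_finitely_covered[OF Ks] finitely_covered_def by blast
  have "inv a \<otimes> g \<otimes> a \<in> K"
    if g: "g \<in> carrier G" "\<forall>a\<in>T. inv a \<otimes> g \<otimes> a \<in> K" and a: "a \<in> carrier G" for g a
  proof -
    obtain t k where t: "t \<in> T" "k \<in> K" "a = t \<otimes> k" using a T(3) by (auto simp: set_mult_def)
    have tG: "t \<in> carrier G" "k \<in> carrier G" using t T subgroup.mem_carrier[OF Ks] by auto
    have "inv a \<otimes> g \<otimes> a = inv k \<otimes> (inv t \<otimes> g \<otimes> t) \<otimes> k"
      using t(3) tG g by (simp add: m_assoc inv_mult_group)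
    then show ?thesis
      using g(2) t Ks by (simp add: subgroup.m_closed subgroup.m_inv_closed)
  qed
  then have "?N = {g \<in> carrier G. \<forall>a\<in>T. inv a \<otimes> g \<otimes> a \<in> K}" using T(2) by auto
  then show "finite_index_subgroup ?N G"
    using finite_index_conjugates[OF K T(1,2)] by simp
  show "?N \<subseteq> K"
  proof
    fix g assume g: "g \<in> ?N"
    then have "inv \<one> \<otimes> g \<otimes> \<one> \<in> K" by blast
    then show "g \<in> K" using g by simp
  qed
  show "?N \<lhd> G"
  proof (rule normal_invI)
    show "subgroup ?N G" by (rule subgroup_conjugates[OF Ks]) simp
    fix x h assume x: "x \<in> carrier G" and h: "h \<in> ?N"
    have "inv a \<otimes> (x \<otimes> h \<otimes> inv x) \<otimes> a \<in> K" if a: "a \<in> carrier G" for a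
    proof -
      have "inv (inv x \<otimes> a) \<otimes> h \<otimes> (inv x \<otimes> a) \<in> K" using h x a by blast
      then show ?thesis using h x a by (simp add: inv_mult_group m_assoc)
    qed
    then show "x \<otimes> h \<otimes> inv x \<in> ?N" using x h by simp
  qed
qed

text \<open>Modulo a normal subgroup, conjugates of a nontrivial element stay nontrivial; so for
  normal subgroups the separation of conjugacy classes reduces to the separation of
  elements.\<close>

lemma normal_separates_conjugacy_class:
  assumes N: "N \<lhd> G" and g: "g \<in> carrier G" "g \<notin> N"
  shows "N \<inter> (conjugacy_class G g <#> N) = {}"
proof (rule ccontr)
  assume "N \<inter> (conjugacy_class G g <#> N) \<noteq> {}"
  then obtain k h where k: "k \<in> carrier G" and h: "h \<in> N" "k \<otimes> g \<otimes> inv k \<otimes> h \<in> N"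
    by (auto simp: set_mult_def conjugacy_class_def)
  interpret normal N G by (rule N)
  have hG: "h \<in> carrier G" using h by simp
  have "(k \<otimes> g \<otimes> inv k \<otimes> h) \<otimes> inv h \<in> N" using h by simp
  then have "k \<otimes> g \<otimes> inv k \<in> N" using k g hG by (simp add: m_assoc)
  then have "inv k \<otimes> (k \<otimes> g \<otimes> inv k) \<otimes> k \<in> N" using k by (rule inv_op_closed1[rotated])
  then show False using k g by (simp add: m_assoc inv_cancel_left)
qed

text \<open>Enumerate the group and intersect successively with normal finite index subgroups, the
  \<open>n\<close>-th of which avoids the \<open>n\<close>-th element unless that is
  \<open>\<one>\<close>.\<close>

lemma regular_approximation_exists:
  assumes cnt: "countable (carrier G)"
    and sep: "\<And>g. g \<in> carrier G \<Longrightarrow> g \<noteq> \<one> \<Longrightarrow> \<exists>K. finite_index_subgroup K G \<and> g \<notin> K"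
  shows "\<exists>\<sigma>. regular_approximation G \<sigma>"
proof -
  have "\<exists>N. finite_index_subgroup N G \<and> N \<lhd> G \<and> (g \<noteq> \<one> \<longrightarrow> g \<notin> N)" if gG: "g \<in> carrier G" for g
  proof (cases "g = \<one>")
    case True
    then show ?thesis using finite_index_subgroup_carrier normal_self by metis
  next
    case False
    obtain K where K: "finite_index_subgroup K G" "g \<notin> K" using sep[OF gG False] by blast
    obtain N where "finite_index_subgroup N G" "N \<lhd> G" "N \<subseteq> K"
      by (rule finite_index_normal_core[OF K(1)])
    then show ?thesis using K(2) by blast
  qed
  then obtain N where N: "\<And>g. g \<in> carrier G \<Longrightarrow> finite_index_subgroup (N g) G"
    "\<And>g. g \<in> carrier G \<Longrightarrow> N g \<lhd> G" "\<And>g. g \<in> carrier G \<Longrightarrow> g \<noteq> \<one> \<Longrightarrow> g \<notin> N g"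
    by metis
  \<comment> \<open>This enumeration hits every element of the countable carrier, with repetitions
    if the group is finite. The element \<open>e n\<close> is dealt with by
    \<open>\<sigma> (Suc n)\<close>, since \<open>\<sigma> 0\<close> is the whole group.\<close>
  define e where "e = from_nat_into (carrier G)"
  have e: "e n \<in> carrier G" for n
    unfolding e_def by (rule from_nat_into) (use one_closed in blast)
  define \<sigma> where "\<sigma> = rec_nat (carrier G) (\<lambda>n A. A \<inter> N (e n))"
  have \<sigma>: "\<sigma> 0 = carrier G" "\<And>n. \<sigma> (Suc n) = \<sigma> n \<inter> N (e n)" by (auto simp: \<sigma>_def)
  have fi: "finite_index_subgroup (\<sigma> n) G" for n
    by (induction n) (auto simp: \<sigma> e N finite_index_subgroup_Int finite_index_subgroup_carrier)
  have nor: "\<sigma> n \<lhd> G" for n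
  proof (induction n)
    case 0
    show ?case unfolding \<sigma> by (rule normal_self)
  next
    case (Suc n)
    then show ?case
      unfolding \<sigma> using N(2)[OF e, of n] by (simp add: normal_inv_iff subgroups_Inter_pair)
  qed
  show ?thesis
    unfolding regular_approximation_def
  proof (intro exI[of _ \<sigma>] conjI allI ballI)
    show "finite_index_subgroup (\<sigma> n) G" for n by (rule fi)
    show "\<sigma> (Suc n) \<subseteq> \<sigma> n" for n by (simp add: \<sigma>)
    fix g assume g: "g \<in> carrier G - {\<one>}"
    then obtain n where "g = e n"
      unfolding e_def using from_nat_into_surj[OF cnt] by (metis DiffD1)
    then have "g \<notin> \<sigma> (Suc n)" using N(3)[of g] g by (simp add: \<sigma>)
    then show "\<exists>n. \<sigma> n \<inter> (conjugacy_class G g <#> \<sigma> n) = {}"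
      using normal_separates_conjugacy_class[OF nor, of g "Suc n"] g by blast
  qed
qed

section \<open>Finite index overgroups of nilpotent groups\<close>

text \<open>A coset representative is carried leftwards through the word:
  \<open>s \<otimes> t = t' \<otimes> u\<close> turns each letter \<open>s\<close> into one letter
  \<open>u\<close> of \<open>H\<close>. Word length is preserved, so growth passes from
  \<open>H\<close> to \<open>G\<close> up to the factor \<open>card T\<close>.\<close>

lemma Schreier_generators:
  assumes H: "subgroup H G" and S: "finite S" "S \<subseteq> carrier G"
    and T: "finite T" "T \<subseteq> carrier G" "carrier G \<subseteq> T <#> H" "\<one> \<in> T"
  obtains U where "finite U" "U \<subseteq> H" "\<And>n. word_ball G S n \<subseteq> T <#> word_ball G U n"
proof -
  \<comment> \<open>All elements of this form that lie in \<open>H\<close> are taken, so no choice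
    of a unique representative \<open>t'\<close> has to be fixed.\<close>
  define U where "U = (\<lambda>(t', s, t). inv t' \<otimes> (s \<otimes> t)) ` (T \<times> insert \<one> S \<times> T) \<inter> H"
  have U: "finite U" "U \<subseteq> H" using S T by (auto simp: U_def)
  have UG: "U \<subseteq> carrier G" using U subgroup.subset[OF H] by blast
  have "word_ball G S n \<subseteq> T <#> word_ball G U n" for n
  proof (induction n)
    case 0
    show ?case using T(4) by (force simp: set_mult_def)
  next
    case (Suc n)
    show ?case
    proof
      fix g assume "g \<in> word_ball G S (Suc n)"
      \<comment> \<open>Balls are built by appending letters on the right, whereas the
        representative stands on the left; so the first letter is split off.\<close>
      moreover have "word_ball G S (Suc n) = word_ball G S (Suc 0) <#> word_ball G S n"
        using word_ball_add[OF S(2), of "Suc 0" n] by (simp del: word_ball.simps)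
      ultimately have "g \<in> insert \<one> S <#> word_ball G S n"
        unfolding word_ball_1[OF S(2)] by simp
      then obtain s v where s: "s \<in> insert \<one> S" "v \<in> word_ball G S n" "g = s \<otimes> v"
        by (auto simp: set_mult_def)
      obtain t w where t: "t \<in> T" "w \<in> word_ball G U n" "v = t \<otimes> w"
        using s(2) Suc.IH by (auto simp: set_mult_def)
      have G: "s \<in> carrier G" "t \<in> carrier G" "w \<in> carrier G"
        using s(1) t(1,2) S(2) T(2) word_ball_subset_carrier[OF UG, of n] by auto
      have "s \<otimes> t \<in> T <#> H" using G T(3) by blast
      then obtain t' u where t': "t' \<in> T" "u \<in> H" "s \<otimes> t = t' \<otimes> u"
        by (auto simp: set_mult_def)
      have G': "t' \<in> carrier G" "u \<in> carrier G" using t' T subgroup.mem_carrier[OF H] by auto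
      have u: "u = inv t' \<otimes> (s \<otimes> t)" using t'(3) G' by (simp add: inv_cancel_left)
      have "u \<in> U"
        unfolding U_def
      proof
        show "u \<in> (\<lambda>(t', s, t). inv t' \<otimes> (s \<otimes> t)) ` (T \<times> insert \<one> S \<times> T)"
          using u s(1) t(1) t'(1) by (intro image_eqI[of _ _ "(t', s, t)"]) auto
      qed (use t' in simp)
      then have "u \<otimes> w \<in> word_ball G U (1 + n)"
        by (intro word_ball_mult[OF UG] t word_ball_incl[OF UG]) auto
      moreover have "g = t' \<otimes> (u \<otimes> w)"
        using s(3) t(3) t'(3) G G' by (simp flip: m_assoc)
      ultimately show "g \<in> T <#> word_ball G U (Suc n)"
        using t'(1) by (auto simp: set_mult_def simp del: word_ball.simps)
    qed
  qed
  with U show thesis by (rule that)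
qed

lemma word_ball_consistent: "word_ball (G\<lparr>carrier := H\<rparr>) S n = word_ball G S n"
  by (induction n) (auto simp: set_mult_def)

lemma virtually_nilpotentE:
  assumes "virtually_nilpotent_group G" "finite S" "S \<subseteq> carrier G"
  obtains H T U c where "finite_index_subgroup H G" "subgroup H G" "finite T" "T \<subseteq> carrier G"
    "lower_central (G\<lparr>carrier := H\<rparr>) c = {\<one>}"
    "finite U" "U \<subseteq> H" "\<And>n. word_ball G S n \<subseteq> T <#> word_ball G U n"
proof -
  obtain H c where H: "finite_index_subgroup H G" "lower_central (G\<lparr>carrier := H\<rparr>) c = {\<one>}"
    using assms(1) unfolding virtually_nilpotent_group_def nilpotent_group_def by auto
  have Hs: "subgroup H G" using H by (simp add: finite_index_subgroup_def)
  obtain T where T: "finite T" "T \<subseteq> carrier G" "carrier G \<subseteq> T <#> H"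
    using H(1) unfolding finite_index_iff_finitely_covered[OF Hs] finitely_covered_def by blast
  have T': "carrier G \<subseteq> insert \<one> T <#> H" using T(3) by (auto simp: set_mult_def)
  obtain U where "finite U" "U \<subseteq> H" "\<And>n. word_ball G S n \<subseteq> insert \<one> T <#> word_ball G U n"
    using Schreier_generators[OF Hs assms(2,3) _ _ T'] T(1,2) by auto
  then show thesis
    using that[OF H(1) Hs _ _ H(2), of "insert \<one> T" U] T by auto
qed

lemma virtually_nilpotent_polynomial_growth:
  assumes "virtually_nilpotent_group G" "finite S" "S \<subseteq> carrier G"
  shows "\<exists>C D. \<forall>n. card (word_ball G S n) \<le> C * Suc n ^ D"
proof -
  obtain H T U c where H: "subgroup H G" "finite T" "lower_central (G\<lparr>carrier := H\<rparr>) c = {\<one>}"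
    "finite U" "U \<subseteq> H" "\<And>n. word_ball G S n \<subseteq> T <#> word_ball G U n"
    using virtually_nilpotentE[OF assms] by metis
  interpret H: group "G\<lparr>carrier := H\<rparr>" by (rule subgroup_imp_group[OF H(1)])
  obtain D where D: "\<And>n. card (word_ball G U n) \<le> Suc n ^ D"
    using H.nilpotent_polynomial_growth[of c U] H(3,4,5) by (auto simp: word_ball_consistent)
  have "card (word_ball G S n) \<le> card T * Suc n ^ D" for n
  proof -
    have "card (word_ball G S n) \<le> card (T \<times> word_ball G U n)"
      using H(2,4) H(6)[of n] finite_word_ball[of U n]
      by (intro surj_card_le[of _ _ "\<lambda>(t, w). t \<otimes> w"]) (auto simp: set_mult_def)
    also have "\<dots> \<le> card T * Suc n ^ D"
      unfolding card_cartesian_product by (intro mult_left_mono D) simp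
    finally show ?thesis .
  qed
  then show ?thesis by blast
qed

text \<open>If \<open>g\<close> is outside \<open>H\<close>, then \<open>H\<close> separates it.
  Otherwise residual finiteness of the nilpotent group \<open>H\<close> applies, and finite index is
  transitive; what has to be supplied is a finite generating set of \<open>H\<close>.\<close>

lemma virtually_nilpotent_residually_finite:
  assumes "virtually_nilpotent_group G" "finite S" "S \<subseteq> carrier G" "\<And>s. s \<in> S \<Longrightarrow> inv s \<in> S"
    and gen: "generate G S = carrier G" and g: "g \<in> carrier G" "g \<noteq> \<one>"
  shows "\<exists>K. finite_index_subgroup K G \<and> g \<notin> K"
proof -
  obtain H T U c where H: "finite_index_subgroup H G" "subgroup H G" "finite T" "T \<subseteq> carrier G"
    "lower_central (G\<lparr>carrier := H\<rparr>) c = {\<one>}"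
    "finite U" "U \<subseteq> H" "\<And>n. word_ball G S n \<subseteq> T <#> word_ball G U n"
    using virtually_nilpotentE[OF assms(1-3)] by metis
  interpret H: group "G\<lparr>carrier := H\<rparr>" by (rule subgroup_imp_group[OF H(2)])
  show ?thesis
  proof (cases "g \<in> H")
    case False
    then show ?thesis using H(1) by blast
  next
    case True
    \<comment> \<open>An element \<open>h = t \<otimes> w\<close> of \<open>H\<close> with
      \<open>w\<close> in the span of \<open>U\<close> has \<open>t \<in> H\<close> too, so these
      representatives complete \<open>U\<close> to a generating set.\<close>
    let ?S = "U \<union> (T \<inter> H)"
    have UG: "U \<subseteq> carrier G" using H(7) subgroup.subset[OF H(2)] by blast
    have "H \<subseteq> generate G ?S"
    proof
      fix h assume h: "h \<in> H"
      then have hG: "h \<in> carrier G" using subgroup.mem_carrier[OF H(2)] by blast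
      then obtain n where "h \<in> word_ball G S n"
        using generate_subset_word_balls[OF assms(3,4)] gen by blast
      then have "h \<in> T <#> word_ball G U n" using H(8) by blast
      then obtain t w where t: "t \<in> T" "w \<in> word_ball G U n" "h = t \<otimes> w"
        by (auto simp: set_mult_def)
      have w: "w \<in> generate G U" using t(2) word_ball_subset_generate[OF UG] by blast
      then have wH: "w \<in> H" using generate_subgroup_incl[OF H(7,2)] by blast
      have G: "t \<in> carrier G" "w \<in> carrier G" using t H(4) wH subgroup.mem_carrier[OF H(2)] by auto
      have "t = h \<otimes> inv w" using t(3) G by (simp add: m_assoc)
      then have "t \<in> H" using h wH H(2) by (simp add: subgroup.m_closed subgroup.m_inv_closed)
      then have "t \<in> generate G ?S" "w \<in> generate G ?S"
        using t(1) w mono_generate[of U ?S] by (auto intro: generate.incl)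
      then show "h \<in> generate G ?S" using t(3) by (simp add: generate.eng)
    qed
    moreover have SH: "?S \<subseteq> H" using H(7) by blast
    ultimately have gen_H: "generate (G\<lparr>carrier := H\<rparr>) ?S = H"
      using generate_consistent[OF SH H(2)] generate_subgroup_incl[OF SH H(2)] by simp
    obtain K where K: "subgroup K (G\<lparr>carrier := H\<rparr>)" "finitely_covered (G\<lparr>carrier := H\<rparr>) H K" "g \<notin> K"
      using H.nilpotent_residually_finite[of c ?S g] H(3,5,6) SH gen_H True g(2) by auto
    have Ks: "subgroup K G" by (rule incl_subgroup[OF H(2) K(1)])
    have HK: "finitely_covered G H K"
      using K(2) subgroup.subset[OF H(2)] unfolding finitely_covered_def by auto
    have "finitely_covered G (carrier G) H"
      using H(1) finite_index_iff_finitely_covered[OF H(2)] by simp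
    then have "finitely_covered G (carrier G) K"
      using HK subgroup.subset[OF Ks] by (rule finitely_covered_trans)
    then have "finite_index_subgroup K G"
      using finite_index_iff_finitely_covered[OF Ks] by simp
    with K(3) show ?thesis by blast
  qed
qed

end

section \<open>Asymptotic dimension of box spaces\<close>

text \<open>If the inequality failed with \<open>M = k ^ Suc D\<close> at all
  \<open>r \<ge> r0\<close>, then iterating along \<open>r1, k * r1, k ^ 2 * r1, \<dots>\<close>
  would make \<open>f\<close> grow with degree at least \<open>D + 1\<close>, against the bound of
  degree \<open>D\<close>.\<close>

lemma polynomial_growth_doubling:
  fixes f :: "nat \<Rightarrow> nat"
  assumes growth: "\<And>n. f n \<le> C * Suc n ^ D" and pos: "\<And>n. 0 < f n" and k: "1 < k"
  shows "\<exists>M. \<forall>r0. \<exists>r\<ge>r0. f (k * r) \<le> M * f r"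
proof (rule exI[of _ "k ^ Suc D"], rule allI, rule ccontr)
  fix r0
  assume "\<not> (\<exists>r\<ge>r0. f (k * r) \<le> k ^ Suc D * f r)"
  then have less: "k ^ Suc D * f r \<le> f (k * r)" if "r0 \<le> r" for r
    using that by (meson nat_le_linear)
  \<comment> \<open>Being positive, \<open>r1\<close> allows the estimate
    \<open>Suc (k ^ j * r1) \<le> 2 * (k ^ j * r1)\<close> below.\<close>
  define r1 where "r1 = Suc r0"
  have growth_lower: "(k ^ Suc D) ^ j \<le> f (k ^ j * r1)" for j
  proof (induction j)
    case 0
    then show ?case using pos[of r1] by simp
  next
    case (Suc j)
    have "r1 \<le> k ^ j * r1" using k by simp
    then have "r0 \<le> k ^ j * r1" by (simp add: r1_def)
    have "(k ^ Suc D) ^ Suc j = k ^ Suc D * (k ^ Suc D) ^ j" by (rule power_Suc)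
    also have "\<dots> \<le> k ^ Suc D * f (k ^ j * r1)" by (intro mult_left_mono Suc.IH) simp
    also have "\<dots> \<le> f (k * (k ^ j * r1))" by (rule less) fact
    also have "\<dots> = f (k ^ Suc j * r1)" by (simp add: mult.assoc)
    finally show ?case .
  qed
  have "k ^ j \<le> C * (2 * r1) ^ D" for j
  proof -
    have "k ^ j * (k ^ j) ^ D = (k ^ Suc D) ^ j"
      by (metis power_Suc power_mult mult.commute)
    also have "\<dots> \<le> f (k ^ j * r1)" by (rule growth_lower)
    also have "\<dots> \<le> C * Suc (k ^ j * r1) ^ D" by (rule growth)
    also have "\<dots> \<le> C * (2 * (k ^ j * r1)) ^ D"
      using k by (intro mult_left_mono power_mono) (auto simp: r1_def Suc_le_eq)
    also have "\<dots> = C * (2 * r1) ^ D * (k ^ j) ^ D"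
      by (simp add: power_mult_distrib mult_ac)
    finally show ?thesis using k by simp
  qed
  \<comment> \<open>With \<open>B = C * (2 * r1) ^ D\<close> and \<open>j = B\<close> this reads
    \<open>k ^ B \<le> B\<close>, while \<open>B < 2 ^ B \<le> k ^ B\<close>.\<close>
  from this[of "C * (2 * r1) ^ D"] show False
    using k less_exp[of "C * (2 * r1) ^ D"] power_mono[of 2 k "C * (2 * r1) ^ D"] by linarith
qed

text \<open>Greedy colouring: a new vertex has at most \<open>M\<close> coloured neighbours, which
  leaves one of the \<open>M + 1\<close> colours \<open>0, \<dots>, M\<close> free.\<close>

lemma bounded_degree_colouring:
  assumes "finite Z" and sym: "\<And>x y. E x y \<Longrightarrow> E y x"
    and "\<forall>z\<in>Z. card {y \<in> Z. E z y} \<le> M"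
  shows "\<exists>col :: 'a \<Rightarrow> nat. (\<forall>z\<in>Z. col z \<le> M) \<and> (\<forall>y\<in>Z. \<forall>z\<in>Z. y \<noteq> z \<and> E y z \<longrightarrow> col y \<noteq> col z)"
  using assms(1,3)
proof (induction Z)
  case (insert z Z)
  have deg: "\<forall>x\<in>Z. card {y \<in> Z. E x y} \<le> M"
  proof
    fix x assume "x \<in> Z"
    have "card {y \<in> Z. E x y} \<le> card {y \<in> Set.insert z Z. E x y}"
      using insert.hyps by (intro card_mono) auto
    also have "\<dots> \<le> M" using insert.prems \<open>x \<in> Z\<close> by blast
    finally show "card {y \<in> Z. E x y} \<le> M" .
  qed
  obtain col :: "'a \<Rightarrow> nat" where col: "\<forall>z\<in>Z. col z \<le> M"
    "\<forall>y\<in>Z. \<forall>z\<in>Z. y \<noteq> z \<and> E y z \<longrightarrow> col y \<noteq> col z"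
    using insert.IH[OF deg] by (elim exE conjE) (rule that)
  have "card (col ` {y \<in> Z. E z y}) \<le> card {y \<in> Z. E z y}"
    using insert.hyps by (intro card_image_le) auto
  also have "\<dots> \<le> card {y \<in> Set.insert z Z. E z y}"
    using insert.hyps by (intro card_mono) auto
  also have "\<dots> < card {..M}" using insert.prems by (simp add: less_Suc_eq_le)
  finally have "\<not> {..M} \<subseteq> col ` {y \<in> Z. E z y}"
    using insert.hyps card_mono[of "col ` {y \<in> Z. E z y}" "{..M}"] by auto
  then obtain c where c: "c \<le> M" "c \<notin> col ` {y \<in> Z. E z y}" by auto
  have "c \<noteq> col y" if "y \<in> Z" "E z y \<or> E y z" for y
    using c(2) sym[of y z] that by auto
  then show ?case
    using c(1) col insert.hyps by (intro exI[of _ "col(z := c)"]) auto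
qed simp

section \<open>Covers of a single coset space, uniform in the subgroup\<close>

context group
begin

lemma finite_subset_word_ball:
  assumes S: "S \<subseteq> carrier G" and "finite F" "F \<subseteq> (\<Union>n. word_ball G S n)"
  shows "\<exists>n. F \<subseteq> word_ball G S n"
  using assms(2,3)
proof (induction F)
  case (insert x F)
  then obtain m n where "F \<subseteq> word_ball G S m" "x \<in> word_ball G S n" by auto
  moreover have "word_ball G S m \<subseteq> word_ball G S (m + n)" "word_ball G S n \<subseteq> word_ball G S (m + n)"
    by (intro word_ball_mono[OF S]; simp)+
  ultimately show ?case by (intro exI[of _ "m + n"]) blast
qed simp

lemma lcoset_translate:
  assumes L: "subgroup L G" and X: "X \<in> lcosets L"
  shows "g \<in> carrier G \<Longrightarrow> g <# X \<in> lcosets L" "X \<subseteq> carrier G" "\<one> <# X = X"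
    "g \<in> carrier G \<Longrightarrow> h \<in> carrier G \<Longrightarrow> g <# (h <# X) = (g \<otimes> h) <# X"
    "X \<noteq> {}"
proof -
  obtain a where a: "a \<in> carrier G" "X = a <# L" using X by (auto simp: LCOSETS_def)
  note LG = subgroup.subset[OF L]
  show XG: "X \<subseteq> carrier G" using a LG by (simp add: l_coset_subset_G)
  show "\<one> <# X = X" using XG by (rule lcos_mult_one)
  show "g \<in> carrier G \<Longrightarrow> h \<in> carrier G \<Longrightarrow> g <# (h <# X) = (g \<otimes> h) <# X"
    using XG by (rule lcos_m_assoc)
  show "g \<in> carrier G \<Longrightarrow> g <# X \<in> lcosets L"
    using a LG by (auto simp: lcos_m_assoc LCOSETS_def)
  show "X \<noteq> {}" using a L lcos_self by blast
qed

text \<open>The radii: centres are \<open>2 * r\<close>-dense, so balls of radius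
  \<open>2 * r + r = 3 * r\<close> contain every \<open>r\<close>-ball; two such balls that meet
  have centres at distance at most \<open>6 * r\<close>; and \<open>r\<close>-balls around these
  centres lie within radius \<open>7 * r\<close>. The last count takes place in the group, so
  \<open>M\<close> is the same for all \<open>L\<close>.\<close>

lemma coset_space_cover:
  assumes S: "finite S" "S \<subseteq> carrier G" "\<And>s. s \<in> S \<Longrightarrow> inv s \<in> S"
    and L: "finite_index_subgroup L G"
    and dbl: "card (word_ball G S (7 * r)) \<le> M * card (word_ball G S r)"
  shows "\<exists>V :: nat \<Rightarrow> 'a set set set.
    (\<forall>l\<le>M. pairwise disjnt (V l)) \<and>
    (\<forall>l\<le>M. \<forall>U\<in>V l. \<exists>z\<in>lcosets L. U = (\<lambda>g. g <# z) ` word_ball G S (3 * r)) \<and>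
    (\<forall>x\<in>lcosets L. \<exists>l\<le>M. \<exists>U\<in>V l. (\<lambda>g. g <# x) ` word_ball G S r \<subseteq> U)"
proof -
  have Ls: "subgroup L G" and fin: "finite (lcosets L)"
    using L by (auto simp: finite_index_subgroup_def)
  let ?B = "word_ball G S"
  note tr = lcoset_translate[OF Ls]
  note BG = word_ball_subset_carrier[OF S(2), THEN subsetD]
  \<comment> \<open>This says that the distance in the Schreier graph of the cosets is at most
    \<open>n\<close>.\<close>
  define near where "near = (\<lambda>n x y. \<exists>g\<in>?B n. y = g <# x)"
  have near_refl: "near n x x" if "x \<in> lcosets L" for n x
    using tr(3)[OF that] one_in_word_ball unfolding near_def by metis
  have near_sym: "near n y x" if x: "x \<in> lcosets L" and xy: "near n x y" for n x y
  proof -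
    obtain g where g: "g \<in> ?B n" "y = g <# x" using xy unfolding near_def by blast
    then have "x = inv g <# y" using tr(3,4)[OF x] BG[of g n] by simp
    then show ?thesis using word_ball_inv[OF S(2,3) g(1)] unfolding near_def by blast
  qed
  have near_trans: "near (m + n) x z" if x: "x \<in> lcosets L" and xyz: "near m x y" "near n y z" for m n x y z
  proof -
    obtain g h where g: "g \<in> ?B m" "y = g <# x" "h \<in> ?B n" "z = h <# y"
      using xyz unfolding near_def by blast
    then have "z = (h \<otimes> g) <# x" using tr(4)[OF x] BG by simp
    moreover have "h \<otimes> g \<in> ?B (m + n)"
      using word_ball_mult[OF S(2) g(3,1)] by (simp add: add.commute)
    ultimately show ?thesis unfolding near_def by blast
  qed
  define sep where "sep = {Z. Z \<subseteq> lcosets L \<and> (\<forall>x\<in>Z. \<forall>y\<in>Z. near (2 * r) x y \<longrightarrow> x = y)}"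
  have "finite sep" using fin by (auto simp: sep_def intro: finite_subset[of _ "Pow (lcosets L)"])
  moreover have "{} \<in> sep" by (simp add: sep_def)
  ultimately obtain Z where Z: "Z \<in> sep" "\<And>Z'. Z' \<in> sep \<Longrightarrow> Z \<subseteq> Z' \<Longrightarrow> Z = Z'"
    using finite_has_maximal[of sep] by blast
  have ZL: "Z \<subseteq> lcosets L" and Zsep: "\<And>x y. x \<in> Z \<Longrightarrow> y \<in> Z \<Longrightarrow> near (2 * r) x y \<Longrightarrow> x = y"
    using Z(1) by (auto simp: sep_def)
  have finZ: "finite Z" using ZL fin finite_subset by blast
  \<comment> \<open>Maximality: a coset far from all of \<open>Z\<close> could be added to
    \<open>Z\<close>.\<close>
  have dense: "\<exists>z\<in>Z. near (2 * r) z x" if x: "x \<in> lcosets L" for x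
  proof (rule ccontr)
    assume no: "\<not> (\<exists>z\<in>Z. near (2 * r) z x)"
    then have "insert x Z \<in> sep"
      using ZL x Zsep near_sym[of x] unfolding sep_def by blast
    then have "x \<in> Z" using Z(2)[of "insert x Z"] by blast
    then show False using no near_refl x by blast
  qed
  have degree: "card {y \<in> Z. near (6 * r) z y} \<le> M" if z: "z \<in> Z" for z
  proof -
    let ?Y = "{y \<in> Z. near (6 * r) z y}"
    have zL: "z \<in> lcosets L" using z ZL by blast
    have "\<forall>y\<in>?Y. \<exists>h. h \<in> ?B (6 * r) \<and> y = h <# z" by (auto simp: near_def)
    from bchoice[OF this] obtain g where
      g: "\<And>y. y \<in> ?Y \<Longrightarrow> g y \<in> ?B (6 * r)" "\<And>y. y \<in> ?Y \<Longrightarrow> y = g y <# z"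
      by blast
    \<comment> \<open>Since \<open>Z\<close> is separated, the translates \<open>B r (g y)\<close> are disjoint already in the group.\<close>
    have "inj_on (\<lambda>(y, b). b \<otimes> g y) (?Y \<times> ?B r)"
    proof (rule inj_onI, clarify)
      fix y b y' b'
      assume y: "y \<in> Z" "near (6 * r) z y" "y' \<in> Z" "near (6 * r) z y'"
        and b: "b \<in> ?B r" "b' \<in> ?B r" and eq: "b \<otimes> g y = b' \<otimes> g y'"
      have G: "b \<in> carrier G" "b' \<in> carrier G" "g y \<in> carrier G" "g y' \<in> carrier G"
        using b BG g(1) y by blast+
      have "g y = inv b \<otimes> (b \<otimes> g y)" using G by (simp add: inv_cancel_left)
      then have "g y = (inv b \<otimes> b') \<otimes> g y'" using eq G by (simp add: m_assoc)
      then have "g y <# z = (inv b \<otimes> b') <# (g y' <# z)"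
        using tr(4)[OF zL] G by simp
      then have "y = (inv b \<otimes> b') <# y'"
        using g(2)[of y] g(2)[of y'] y by simp
      moreover have "inv b \<otimes> b' \<in> ?B (r + r)"
        using word_ball_mult[OF S(2) word_ball_inv[OF S(2,3) b(1)] b(2)] .
      ultimately have "near (2 * r) y' y" unfolding near_def mult_2 by blast
      then have "y' = y" using Zsep y by blast
      then show "y = y' \<and> b = b'" using eq G by simp
    qed
    moreover have "(\<lambda>(y, b). b \<otimes> g y) ` (?Y \<times> ?B r) \<subseteq> ?B (7 * r)"
    proof clarify
      fix y b assume "y \<in> Z" "near (6 * r) z y" "b \<in> ?B r"
      then have "b \<otimes> g y \<in> ?B (r + 6 * r)"
        using g(1)[of y] by (intro word_ball_mult[OF S(2)]) auto
      then show "b \<otimes> g y \<in> ?B (7 * r)" by simp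
    qed
    ultimately have "card (?Y \<times> ?B r) \<le> card (?B (7 * r))"
      using finite_word_ball[OF S(1), of "7 * r"] by (intro card_inj_on_le) auto
    also have "\<dots> \<le> M * card (?B r)" by (rule dbl)
    finally have "card ?Y * card (?B r) \<le> M * card (?B r)" by (simp add: card_cartesian_product)
    moreover have "0 < card (?B r)"
      using one_in_word_ball[of S r] finite_word_ball[OF S(1)] by (auto simp: card_gt_0_iff)
    ultimately show ?thesis by simp
  qed
  \<comment> \<open>The colouring lemma asks for symmetry at all points, while \<open>near\<close>
    is known to be symmetric only on cosets of \<open>L\<close>.\<close>
  define E where "E = (\<lambda>y z. y \<in> lcosets L \<and> z \<in> lcosets L \<and> near (6 * r) y z)"
  have "\<exists>col :: 'a set \<Rightarrow> nat. (\<forall>z\<in>Z. col z \<le> M) \<and> (\<forall>y\<in>Z. \<forall>z\<in>Z. y \<noteq> z \<and> E y z \<longrightarrow> col y \<noteq> col z)"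
  proof (rule bounded_degree_colouring[OF finZ _ ballI])
    show "E y x" if "E x y" for x y using that near_sym by (auto simp: E_def)
    fix z assume z: "z \<in> Z"
    have "{y \<in> Z. E z y} = {y \<in> Z. near (6 * r) z y}" using ZL z by (auto simp: E_def)
    then show "card {y \<in> Z. E z y} \<le> M" using degree[OF z] by simp
  qed
  then obtain col :: "'a set \<Rightarrow> nat" where col1: "\<forall>z\<in>Z. col z \<le> M"
    and colE: "\<forall>y\<in>Z. \<forall>z\<in>Z. y \<noteq> z \<and> E y z \<longrightarrow> col y \<noteq> col z"
    by (elim exE conjE) (rule that)
  have col2: "col y \<noteq> col z" if "y \<in> Z" "z \<in> Z" "y \<noteq> z" "near (6 * r) y z" for y z
  proof -
    have "E y z" using that ZL by (auto simp: E_def)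
    then show ?thesis using colE that by simp
  qed
  define U where "U = (\<lambda>z. (\<lambda>g. g <# z) ` ?B (3 * r))"
  have memU: "x \<in> U z \<longleftrightarrow> near (3 * r) z x" for x z by (auto simp: U_def near_def)
  show ?thesis
  proof (intro exI[of _ "\<lambda>l. U ` {z \<in> Z. col z = l}"] conjI allI impI ballI)
    fix l
    show "pairwise disjnt (U ` {z \<in> Z. col z = l})"
    proof (rule pairwiseI, clarify)
      fix y z assume yz: "y \<in> Z" "z \<in> Z" "U y \<noteq> U z" "col z = col y" "l = col y"
      show "disjnt (U y) (U z)"
      proof (rule ccontr)
        assume "\<not> disjnt (U y) (U z)"
        then obtain x where x: "near (3 * r) y x" "near (3 * r) z x"
          by (auto simp: disjnt_iff memU)
        then have "near (3 * r + 3 * r) y z"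
          using near_trans[of y "3 * r" x "3 * r" z] near_sym[of z] yz ZL by blast
        then have "near (6 * r) y z" by simp
        then show False using col2[of y z] yz by auto
      qed
    qed
    show "\<exists>z\<in>lcosets L. W = (\<lambda>g. g <# z) ` ?B (3 * r)" if "W \<in> U ` {z \<in> Z. col z = l}" for W
      using that ZL by (auto simp: U_def)
  next
    fix x assume x: "x \<in> lcosets L"
    obtain z where z: "z \<in> Z" "near (2 * r) z x" using dense[OF x] by blast
    have "(\<lambda>g. g <# x) ` ?B r \<subseteq> U z"
    proof clarify
      fix g assume "g \<in> ?B r"
      then have "near r x (g <# x)" unfolding near_def by blast
      then have "near (2 * r + r) z (g <# x)" using near_trans z ZL by blast
      then show "g <# x \<in> U z" by (simp add: memU)
    qed
    then show "\<exists>l\<le>M. \<exists>W\<in>U ` {z \<in> Z. col z = l}. (\<lambda>g. g <# x) ` ?B r \<subseteq> W"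
      using col1 z by blast
  qed
qed

end

section \<open>Covers of the whole box space\<close>

lemma set_distance_le:
  assumes "\<And>x y. 0 \<le> d x y" "a \<in> A" "b \<in> B"
  shows "set_distance d A B \<le> d a b"
  unfolding set_distance_def using assms by (intro cInf_lower bdd_belowI[of _ 0]) auto

lemma set_distance_lessD:
  assumes "set_distance d A B < R" "A \<noteq> {}" "B \<noteq> {}"
  shows "\<exists>a\<in>A. \<exists>b\<in>B. d a b < R"
  using cInf_lessD[of "{d a b | a b. a \<in> A \<and> b \<in> B}" R] assms unfolding set_distance_def by blast

text \<open>For given \<open>R\<close>, the components with index below \<open>N\<close> are merged
  into one bounded set \<open>W\<close>. Every other component is at distance at least
  \<open>R\<close> from all the rest, so the uniform covers of single coset spaces can be used there
  side by side, with the same \<open>M + 1\<close> colours.\<close>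

lemma asdim_box_space_at_most:
  fixes G :: "('a, 'b) monoid_scheme" (structure)
  assumes G: "group G"
    and S: "finite S" "S \<subseteq> carrier G" "\<And>s. s \<in> S \<Longrightarrow> inv s \<in> S" "generate G S = carrier G"
    and dbl: "\<And>r0. \<exists>r\<ge>r0. card (word_ball G S (7 * r)) \<le> M * card (word_ball G S r)"
    and \<sigma>: "\<And>n. finite_index_subgroup (\<sigma> n) G"
    and d: "proper_right_invariant_metric G d" and dB: "box_space_metric G \<sigma> d dB"
  shows "asdim_at_most (box_space G \<sigma>) dB M"
  unfolding asdim_at_most_def
proof (intro allI impI)
  fix R :: real assume "0 < R"
  interpret group G by (rule G)
  interpret d: Metric_space "carrier G" d
    using d by (simp add: proper_right_invariant_metric_def)
  interpret dB: Metric_space "box_space G \<sigma>" dB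
    using dB by (simp add: box_space_metric_def)
  have inv_d: "d (x \<otimes> g) (y \<otimes> g) = d x y" if "x \<in> carrier G" "y \<in> carrier G" "g \<in> carrier G" for x y g
    using d that by (simp add: proper_right_invariant_metric_def)
  have \<sigma>s: "subgroup (\<sigma> n) G" and fin: "finite (lcosets (\<sigma> n))" for n
    using \<sigma>[of n] by (auto simp: finite_index_subgroup_def)
  have dB_eq: "dB (n, X) (n, Y) = set_distance d X Y" if "X \<in> lcosets (\<sigma> n)" "Y \<in> lcosets (\<sigma> n)" for n X Y
    using dB that by (simp add: box_space_metric_def)
  note tr = lcoset_translate[OF \<sigma>s]
  note BG = word_ball_subset_carrier[OF S(2), THEN subsetD]
  obtain N where N: "\<And>n m. n \<noteq> m \<Longrightarrow> N \<le> n + m \<Longrightarrow>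
      R \<le> set_distance dB (box_component G \<sigma> n) (box_component G \<sigma> m)"
    using dB unfolding box_space_metric_def by metis
  \<comment> \<open>Properness makes this ball finite, so it lies in a word ball. This is the only
    comparison needed between the arbitrary metric \<open>d\<close> and word length.\<close>
  define F where "F = d.mcball \<one> R"
  have "finite F" using d by (simp add: F_def proper_right_invariant_metric_def)
  moreover have "F \<subseteq> (\<Union>n. word_ball G S n)"
    using generate_subset_word_balls[OF S(2,3)] S(4) by (auto simp: F_def d.mcball_def)
  ultimately obtain r0 where "F \<subseteq> word_ball G S r0"
    using finite_subset_word_ball[OF S(2)] by blast
  then obtain r where r: "F \<subseteq> word_ball G S r" 
      "card (word_ball G S (7 * r)) \<le> M * card (word_ball G S r)"
    using dbl[of r0] word_ball_mono[OF S(2)] by blast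
  obtain V :: "nat \<Rightarrow> nat \<Rightarrow> 'a set set set" where
    V: "\<And>n l. l \<le> M \<Longrightarrow> pairwise disjnt (V n l)"
      "\<And>n l U. l \<le> M \<Longrightarrow> U \<in> V n l \<Longrightarrow> \<exists>z\<in>lcosets (\<sigma> n). U = (\<lambda>g. g <# z) ` word_ball G S (3 * r)"
      "\<And>n x. x \<in> lcosets (\<sigma> n) \<Longrightarrow> \<exists>l\<le>M. \<exists>U\<in>V n l. (\<lambda>g. g <# x) ` word_ball G S r \<subseteq> U"
    using coset_space_cover[OF S(1-3) \<sigma> r(2)] by metis
  have V_sub: "U \<subseteq> lcosets (\<sigma> n)" if "l \<le> M" "U \<in> V n l" for n l U
    using V(2)[OF that] tr(1) BG by auto
  define W where "W = (\<Union>n<N. box_component G \<sigma> n)"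
  \<comment> \<open>The set \<open>W\<close> can join colour \<open>0\<close> because all other
    members lie in components with index at least \<open>N\<close>.\<close>
  define \<V> where "\<V> = (\<lambda>l. {Pair n ` U | n U. N \<le> n \<and> U \<in> V n l} \<union> (if l = 0 then {W} else {}))"
  have mem_box: "(n, X) \<in> box_space G \<sigma> \<longleftrightarrow> X \<in> lcosets (\<sigma> n)" for n X
    by (auto simp: box_space_def box_component_def)
  have mem_W: "(n, X) \<in> W \<longleftrightarrow> n < N \<and> X \<in> lcosets (\<sigma> n)" for n X
    by (auto simp: W_def box_component_def)
  have cover: "(\<Union>l\<le>M. \<Union> (\<V> l)) = box_space G \<sigma>"
  proof
    show "(\<Union>l\<le>M. \<Union> (\<V> l)) \<subseteq> box_space G \<sigma>"
      using V_sub mem_box mem_W by (force simp: \<V>_def split: if_splits)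
    show "box_space G \<sigma> \<subseteq> (\<Union>l\<le>M. \<Union> (\<V> l))"
    proof clarify
      fix n X assume "(n, X) \<in> box_space G \<sigma>"
      then have X: "X \<in> lcosets (\<sigma> n)" by (simp add: mem_box)
      show "(n, X) \<in> (\<Union>l\<le>M. \<Union> (\<V> l))"
      proof (cases "n < N")
        case True
        then have "(n, X) \<in> \<Union> (\<V> 0)" using X by (auto simp: \<V>_def mem_W)
        then show ?thesis by blast
      next
        case False
        obtain l U where l: "l \<le> M" "U \<in> V n l" "(\<lambda>g. g <# X) ` word_ball G S r \<subseteq> U"
          using V(3)[OF X] by blast
        have "X \<in> U" using l(3) one_in_word_ball[of S r] tr(3)[OF X] by (metis image_subset_iff)
        then have "(n, X) \<in> \<Union> (\<V> l)" using l False by (auto simp: \<V>_def not_less)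
        then show ?thesis using l(1) by blast
      qed
    qed
  qed
  have bounded: "uniformly_bounded dB (\<Union>l\<le>M. \<V> l)"
  proof -
    have "finite W" using fin by (auto simp: W_def box_component_def)
    \<comment> \<open>The element \<open>0\<close> is inserted so that \<open>Max\<close> is taken
      over a nonempty set even when \<open>W\<close> is empty.\<close>
    define D1 where "D1 = Max (insert 0 ((\<lambda>(x, y). dB x y) ` (W \<times> W)))"
    define D2 where "D2 = Max (insert 0 ((\<lambda>(x, y). d x y) ` (word_ball G S (3 * r) \<times> word_ball G S (3 * r))))"
    have D1: "dB x y \<le> D1" if "x \<in> W" "y \<in> W" for x y
      unfolding D1_def using \<open>finite W\<close> that by (intro Max_ge) auto
    have D2: "d x y \<le> D2" if "x \<in> word_ball G S (3 * r)" "y \<in> word_ball G S (3 * r)" for x y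
      unfolding D2_def using finite_word_ball[OF S(1)] that by (intro Max_ge) auto
    have "dB x y \<le> max D1 D2" if U: "U \<in> \<V> l" "l \<le> M" "x \<in> U" "y \<in> U" for U l x y
    proof (cases "U = W")
      case True
      then show ?thesis using D1[of x y] U by auto
    next
      case False
      then obtain n U' where U': "U = Pair n ` U'" "U' \<in> V n l"
        using U(1) by (auto simp: \<V>_def split: if_splits)
      obtain z where z: "z \<in> lcosets (\<sigma> n)" "U' = (\<lambda>g. g <# z) ` word_ball G S (3 * r)"
        using V(2)[OF U(2) U'(2)] by blast
      obtain g h where gh: "g \<in> word_ball G S (3 * r)" "h \<in> word_ball G S (3 * r)"
        "x = (n, g <# z)" "y = (n, h <# z)"
        using U(3,4) U' z by auto
      obtain a where a: "a \<in> z" "a \<in> carrier G" using tr(2,5)[OF z(1)] by blast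
      \<comment> \<open>Right invariance bounds the quotient distance by \<open>d g h\<close>,
        whatever the coset; so one bound serves all components.\<close>
      have "dB x y = set_distance d (g <# z) (h <# z)"
        unfolding gh using gh(1,2) BG by (intro dB_eq tr(1)[OF z(1)]) auto
      also have "\<dots> \<le> d (g \<otimes> a) (h \<otimes> a)"
        using a(1) by (intro set_distance_le) (auto simp: l_coset_def)
      also have "\<dots> = d g h" using gh(1,2) BG a(2) by (intro inv_d) auto
      also have "\<dots> \<le> D2" by (rule D2[OF gh(1,2)])
      finally show ?thesis by simp
    qed
    then show ?thesis unfolding uniformly_bounded_def by blast
  qed
  have Lebesgue: "Lebesgue_number_at_least (box_space G \<sigma>) dB (\<Union>l\<le>M. \<V> l) R"
    unfolding Lebesgue_number_at_least_def
  proof (intro allI impI, elim conjE exE)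
    fix A r' assume A: "A \<subseteq> box_space G \<sigma>" "A \<noteq> {}" "r' < R" "\<forall>x\<in>A. \<forall>y\<in>A. dB x y \<le> r'"
    show "\<exists>U\<in>\<Union>l\<le>M. \<V> l. A \<subseteq> U"
    proof (cases "A \<subseteq> W")
      case True
      moreover have "W \<in> \<V> 0" by (simp add: \<V>_def)
      ultimately show ?thesis by blast
    next
      case False
      then obtain n X where nX: "(n, X) \<in> A" "(n, X) \<notin> W" by auto
      then have X: "X \<in> lcosets (\<sigma> n)" using A(1) mem_box by blast
      then have n: "N \<le> n" using nX(2) by (simp add: mem_W)
      obtain l U where l: "l \<le> M" "U \<in> V n l" "(\<lambda>g. g <# X) ` word_ball G S r \<subseteq> U"
        using V(3)[OF X] by blast
      have "A \<subseteq> Pair n ` U"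
      proof clarify
        fix m Y assume mY: "(m, Y) \<in> A"
        then have Y: "Y \<in> lcosets (\<sigma> m)" using A(1) mem_box by blast
        have less: "dB (n, X) (m, Y) < R" using A(3,4) nX(1) mY by force
        have "m = n"
        proof (rule ccontr)
          assume "m \<noteq> n"
          \<comment> \<open>From \<open>N \<le> n\<close> follows \<open>N \<le> n + m\<close> for
            every \<open>m\<close>, so even components with small index are far away.\<close>
          then have "R \<le> set_distance dB (box_component G \<sigma> n) (box_component G \<sigma> m)"
            using n by (intro N) auto
          also have "\<dots> \<le> dB (n, X) (m, Y)"
            using X Y by (intro set_distance_le) (auto simp: box_component_def)
          finally show False using less by simp
        qed
        then have YL: "Y \<in> lcosets (\<sigma> n)" using Y by simp
        have "set_distance d X Y < R" using less X YL \<open>m = n\<close> by (simp add: dB_eq)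
        then obtain x y where xy: "x \<in> X" "y \<in> Y" "d x y < R"
          using set_distance_lessD[of d X Y R] tr(5)[OF X] tr(5)[OF YL] by blast
        have xyG: "x \<in> carrier G" "y \<in> carrier G" using xy tr(2)[OF X] tr(2)[OF YL] by auto
        \<comment> \<open>The quotient \<open>y \<otimes> inv x\<close> has the same distance to
          \<open>\<one>\<close> as \<open>y\<close> to \<open>x\<close>, so it lies in
          \<open>F\<close>. The cosets \<open>Y\<close> and \<open>?g <# X\<close> share
          \<open>y\<close> and hence agree.\<close>
        let ?g = "y \<otimes> inv x"
        have "d \<one> ?g = d (\<one> \<otimes> x) (?g \<otimes> x)" using xyG by (intro inv_d[symmetric]) auto
        also have "\<dots> = d x y" using xyG by (simp add: m_assoc)
        finally have "?g \<in> F" using xy(3) xyG by (simp add: F_def)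
        then have g: "?g \<in> word_ball G S r" using r(1) by blast
        have "y = ?g \<otimes> x" using xyG by (simp add: m_assoc)
        then have "y \<in> ?g <# X" using xy(1) by (auto simp: l_coset_def)
        then have "Y = ?g <# X"
          using lcos_disjoint[OF \<sigma>s, of Y n "?g <# X"] YL tr(1)[OF X, of ?g] xy(2) xyG by auto
        then have "Y \<in> U" using l(3) g by blast
        then show "(m, Y) \<in> Pair n ` U" using \<open>m = n\<close> by blast
      qed
      moreover have "Pair n ` U \<in> \<V> l" using n l(2) by (auto simp: \<V>_def)
      ultimately show ?thesis using l(1) by blast
    qed
  qed
  have disj: "pairwise disjnt (\<V> l)" if l: "l \<le> M" for l
  proof (rule pairwiseI)
    have 1: "disjnt (Pair n ` U) (Pair m ` U')"
      if "U \<in> V n l" "U' \<in> V m l" "Pair n ` U \<noteq> Pair m ` U'" for n m U U'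
      using that V(1)[OF l, of n] by (cases "n = m") (auto simp: disjnt_iff pairwise_def)
    have 2: "disjnt (Pair n ` U) W" if "N \<le> n" for n U
      using that by (auto simp: disjnt_iff mem_W)
    have split: "(\<exists>n U. A = Pair n ` U \<and> N \<le> n \<and> U \<in> V n l) \<or> A = W" if "A \<in> \<V> l" for A
      using that by (auto simp: \<V>_def split: if_splits)
    fix A B assume AB: "A \<in> \<V> l" "B \<in> \<V> l" "A \<noteq> B"
    show "disjnt A B"
      using split[OF AB(1)] split[OF AB(2)]
    proof (elim disjE exE conjE)
      fix n m U U' assume "A = Pair n ` U" "U \<in> V n l" "B = Pair m ` U'" "U' \<in> V m l"
      then show ?thesis using 1 AB(3) by simp
    next
      fix n U assume "A = Pair n ` U" "N \<le> n" "B = W"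
      then show ?thesis using 2 by simp
    next
      fix n U assume "A = W" "B = Pair n ` U" "N \<le> n"
      then show ?thesis using disjnt_sym[OF 2] by simp
    qed (use AB in simp)
  qed
  show "\<exists>\<V>. (\<Union>l\<le>M. \<Union> (\<V> l)) = box_space G \<sigma> \<and> uniformly_bounded dB (\<Union>l\<le>M. \<V> l) \<and>
      Lebesgue_number_at_least (box_space G \<sigma>) dB (\<Union>l\<le>M. \<V> l) R \<and> (\<forall>l\<le>M. pairwise disjnt (\<V> l))"
    using cover bounded Lebesgue disj by blast
qed

section \<open>Existence of box space metrics\<close>

definition word_length :: "('a, 'b) monoid_scheme \<Rightarrow> 'a set \<Rightarrow> 'a \<Rightarrow> nat" where
  "word_length G S g = (LEAST n. g \<in> word_ball G S n)"

text \<open>The quotient \<open>x \<otimes> inv y\<close>, and not \<open>inv x \<otimes> y\<close>,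
  makes the metric right-invariant. The value \<open>0\<close> off the carrier respects
  nonnegativity and symmetry, which \<open>Metric_space\<close> demands at all points.\<close>

definition word_metric :: "('a, 'b) monoid_scheme \<Rightarrow> 'a set \<Rightarrow> 'a \<Rightarrow> 'a \<Rightarrow> real" where
  "word_metric G S x y =
     (if x \<in> carrier G \<and> y \<in> carrier G then real (word_length G S (x \<otimes>\<^bsub>G\<^esub> inv\<^bsub>G\<^esub> y)) else 0)"

locale finite_symmetric_generators = group G for G :: "('a, 'b) monoid_scheme" (structure) +
  fixes S :: "'a set"
  assumes finite_S: "finite S" and S_subset: "S \<subseteq> carrier G"
    and S_inv: "\<And>s. s \<in> S \<Longrightarrow> inv s \<in> S" and generate_S: "generate G S = carrier G"
begin

lemma word_length_le_iff:
  assumes "g \<in> carrier G"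
  shows "word_length G S g \<le> n \<longleftrightarrow> g \<in> word_ball G S n"
proof
  assume le: "word_length G S g \<le> n"
  obtain m where "g \<in> word_ball G S m"
    using generate_subset_word_balls[OF S_subset S_inv] generate_S assms by blast
  then have "g \<in> word_ball G S (word_length G S g)"
    unfolding word_length_def by (rule LeastI)
  then show "g \<in> word_ball G S n" using word_ball_mono[OF S_subset le] by blast
next
  assume "g \<in> word_ball G S n"
  then show "word_length G S g \<le> n" unfolding word_length_def by (rule Least_le)
qed

lemma word_length_inv:
  assumes "g \<in> carrier G"
  shows "word_length G S (inv g) = word_length G S g"
proof -
  have "word_length G S (inv h) \<le> word_length G S h" if "h \<in> carrier G" for h
    using word_length_le_iff[of h] word_length_le_iff[of "inv h"] that
      word_ball_inv[OF S_subset S_inv] by blast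
  from this[of g] this[of "inv g"] assms show ?thesis by simp
qed

lemma word_length_mult:
  assumes "g \<in> carrier G" "h \<in> carrier G"
  shows "word_length G S (g \<otimes> h) \<le> word_length G S g + word_length G S h"
  using assms word_length_le_iff word_ball_mult[OF S_subset] by (metis m_closed order_refl)

lemma word_length_eq_0_iff:
  assumes "g \<in> carrier G"
  shows "word_length G S g = 0 \<longleftrightarrow> g = \<one>"
  using word_length_le_iff[OF assms, of 0] by simp

lemma Metric_space_word_metric: "Metric_space (carrier G) (word_metric G S)"
proof
  show "0 \<le> word_metric G S x y" for x y by (simp add: word_metric_def)
  show "word_metric G S x y = word_metric G S y x" for x y
    using word_length_inv[of "x \<otimes> inv y"] by (auto simp: word_metric_def inv_mult_group)
  show "word_metric G S x y = 0 \<longleftrightarrow> x = y" if "x \<in> carrier G" "y \<in> carrier G" for x y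
    using that word_length_eq_0_iff[of "x \<otimes> inv y"] by (auto simp: word_metric_def r_cancel_one' inv_solve_right')
  show "word_metric G S x z \<le> word_metric G S x y + word_metric G S y z"
    if "x \<in> carrier G" "y \<in> carrier G" "z \<in> carrier G" for x y z
  proof -
    have "x \<otimes> inv z = (x \<otimes> inv y) \<otimes> (y \<otimes> inv z)" using that by (simp add: m_assoc inv_cancel_left)
    then show ?thesis
      using word_length_mult[of "x \<otimes> inv y" "y \<otimes> inv z"] that by (simp add: word_metric_def)
  qed
qed

lemma proper_right_invariant_word_metric: "proper_right_invariant_metric G (word_metric G S)"
proof -
  interpret W: Metric_space "carrier G" "word_metric G S" by (rule Metric_space_word_metric)
  have "finite (W.mcball x r)" if x: "x \<in> carrier G" for x r
  proof (rule finite_subset)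
    show "W.mcball x r \<subseteq> (\<lambda>b. inv b \<otimes> x) ` word_ball G S (nat \<lfloor>r\<rfloor>)"
    proof
      fix y assume "y \<in> W.mcball x r"
      then have y: "y \<in> carrier G" "real (word_length G S (x \<otimes> inv y)) \<le> r"
        using x by (auto simp: word_metric_def)
      then have "word_length G S (x \<otimes> inv y) \<le> nat \<lfloor>r\<rfloor>" by (simp add: le_nat_floor)
      then have "x \<otimes> inv y \<in> word_ball G S (nat \<lfloor>r\<rfloor>)"
        using word_length_le_iff[of "x \<otimes> inv y"] x y by simp
      moreover have "y = inv (x \<otimes> inv y) \<otimes> x"
        using x y by (simp add: inv_mult_group m_assoc)
      ultimately show "y \<in> (\<lambda>b. inv b \<otimes> x) ` word_ball G S (nat \<lfloor>r\<rfloor>)" by blast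
    qed
  qed (simp add: finite_word_ball finite_S)
  moreover have "word_metric G S (x \<otimes> g) (y \<otimes> g) = word_metric G S x y"
    if "x \<in> carrier G" "y \<in> carrier G" "g \<in> carrier G" for x y g
  proof -
    have "(x \<otimes> g) \<otimes> inv (y \<otimes> g) = x \<otimes> inv y"
      using that by (simp add: inv_mult_group m_assoc inv_cancel_left)
    then show ?thesis using that by (simp add: word_metric_def)
  qed
  ultimately show ?thesis
    unfolding proper_right_invariant_metric_def using W.Metric_space_axioms by blast
qed

text \<open>The infimum is attained and equals the Schreier graph distance. Points
  \<open>a \<in> X\<close> and \<open>b \<in> Y\<close> give
  \<open>X = (a \<otimes> inv b) <# Y\<close>; conversely \<open>X = g <# Y\<close> gives the pair
  \<open>g \<otimes> b\<close> and \<open>b\<close>, whose distance is the length of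
  \<open>g\<close>.\<close>

lemma set_distance_word_metric:
  assumes L: "subgroup L G" and X: "X \<in> lcosets L" and Y: "Y \<in> lcosets L"
  shows "\<exists>k::nat. set_distance (word_metric G S) X Y = real k \<and>
    (\<forall>n. k \<le> n \<longleftrightarrow> (\<exists>g\<in>word_ball G S n. X = g <# Y))"
proof -
  note tX = lcoset_translate[OF L X] and tY = lcoset_translate[OF L Y]
  define P where "P = (\<lambda>k. \<exists>g\<in>word_ball G S k. X = g <# Y)"
  have pair: "P (word_length G S (a \<otimes> inv b))" if ab: "a \<in> X" "b \<in> Y" for a b
  proof -
    have G: "a \<in> carrier G" "b \<in> carrier G" using ab tX(2) tY(2) by auto
    have "a = (a \<otimes> inv b) \<otimes> b" using G by (simp add: m_assoc)
    then have "a \<in> (a \<otimes> inv b) <# Y" using ab(2) by (auto simp: l_coset_def)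
    then have "X = (a \<otimes> inv b) <# Y"
      using lcos_disjoint[OF L X, of "(a \<otimes> inv b) <# Y"] tY(1)[of "a \<otimes> inv b"] ab(1) G by auto
    moreover have "a \<otimes> inv b \<in> word_ball G S (word_length G S (a \<otimes> inv b))"
      using word_length_le_iff[of "a \<otimes> inv b"] G by blast
    ultimately show ?thesis unfolding P_def by blast
  qed
  define k where "k = (LEAST k. P k)"
  obtain a0 b0 where "a0 \<in> X" "b0 \<in> Y" using tX(5) tY(5) by blast
  then have Pk: "P k" unfolding k_def using pair by (blast intro: LeastI)
  have mono: "P n" if "P m" "m \<le> n" for m n
    using that word_ball_mono[OF S_subset] unfolding P_def by blast
  have k_le: "k \<le> n \<longleftrightarrow> P n" for n
  proof
    assume "P n"
    then show "k \<le> n" unfolding k_def by (rule Least_le)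
  qed (rule mono[OF Pk])
  obtain g where g: "g \<in> word_ball G S k" "X = g <# Y" using Pk unfolding P_def by blast
  have gG: "g \<in> carrier G" using g word_ball_subset_carrier[OF S_subset] by blast
  obtain b where b: "b \<in> Y" "b \<in> carrier G" using tY(2,5) by blast
  have gb: "g \<otimes> b \<in> X" using g(2) b(1) by (auto simp: l_coset_def)
  have "set_distance (word_metric G S) X Y = real k"
    unfolding set_distance_def
  proof (rule cInf_eq_minimum)
    have "word_length G S g \<le> k" using g(1) gG by (simp add: word_length_le_iff)
    moreover have "k \<le> word_length G S (g \<otimes> b \<otimes> inv b)" using pair[OF gb b(1)] k_le by blast
    ultimately have "word_metric G S (g \<otimes> b) b = real k"
      using gG b by (simp add: word_metric_def m_assoc)
    then show "real k \<in> {word_metric G S a b |a b. a \<in> X \<and> b \<in> Y}"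
      using gb b(1) by force
    fix r assume "r \<in> {word_metric G S a b |a b. a \<in> X \<and> b \<in> Y}"
    then obtain a b where ab: "r = word_metric G S a b" "a \<in> X" "b \<in> Y" by blast
    then have "r = real (word_length G S (a \<otimes> inv b))"
      using tX(2) tY(2) by (auto simp: word_metric_def)
    then show "real k \<le> r" using pair[OF ab(2,3)] k_le by simp
  qed
  then show ?thesis using k_le unfolding P_def by blast
qed

text \<open>Distances between sets violate the triangle inequality in general. Here
  \<open>X = g <# Y\<close> and \<open>Y = h <# Z\<close> compose to
  \<open>X = (g \<otimes> h) <# Z\<close>, and word length is subadditive.\<close>

lemma Metric_space_quotient:
  assumes L: "subgroup L G"
  shows "Metric_space (lcosets L)
    (\<lambda>X Y. if X \<in> lcosets L \<and> Y \<in> lcosets L then set_distance (word_metric G S) X Y else 0)"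
    (is "Metric_space _ ?\<delta>")
proof
  note tr = lcoset_translate[OF L]
  show "0 \<le> ?\<delta> X Y" for X Y
  proof (cases "X \<in> lcosets L \<and> Y \<in> lcosets L")
    case True
    then have XY: "X \<in> lcosets L" "Y \<in> lcosets L" by auto
    obtain k :: nat where "set_distance (word_metric G S) X Y = real k"
      using set_distance_word_metric[OF L XY] by (elim exE conjE) (rule that)
    then show ?thesis by simp
  qed auto
  show "?\<delta> X Y = ?\<delta> Y X" for X Y
  proof -
    interpret W: Metric_space "carrier G" "word_metric G S" by (rule Metric_space_word_metric)
    have "{word_metric G S a b |a b. a \<in> X \<and> b \<in> Y} = {word_metric G S a b |a b. a \<in> Y \<and> b \<in> X}"
      using W.commute by blast
    then show ?thesis by (auto simp: set_distance_def)
  qed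
  fix X Y assume XY: "X \<in> lcosets L" "Y \<in> lcosets L"
  obtain k where k: "set_distance (word_metric G S) X Y = real k"
    "\<forall>n. k \<le> n \<longleftrightarrow> (\<exists>g\<in>word_ball G S n. X = g <# Y)"
    using set_distance_word_metric[OF L XY] by (elim exE conjE) (rule that)
  show "?\<delta> X Y = 0 \<longleftrightarrow> X = Y" using k(1) k(2)[rule_format, of 0] XY tr(3)[OF XY(2)] by simp
  fix Z assume Z: "Z \<in> lcosets L"
  obtain m where m: "set_distance (word_metric G S) Y Z = real m"
    "\<forall>n. m \<le> n \<longleftrightarrow> (\<exists>g\<in>word_ball G S n. Y = g <# Z)"
    using set_distance_word_metric[OF L XY(2) Z] by (elim exE conjE) (rule that)
  obtain l where l: "set_distance (word_metric G S) X Z = real l"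
    "\<forall>n. l \<le> n \<longleftrightarrow> (\<exists>g\<in>word_ball G S n. X = g <# Z)"
    using set_distance_word_metric[OF L XY(1) Z] by (elim exE conjE) (rule that)
  obtain g h where gh: "g \<in> word_ball G S k" "X = g <# Y" "h \<in> word_ball G S m" "Y = h <# Z"
    using k(2)[rule_format, of k] m(2)[rule_format, of m] by blast
  have "X = (g \<otimes> h) <# Z"
    using gh tr(4)[OF Z, of g h] word_ball_subset_carrier[OF S_subset] by blast
  then have "l \<le> k + m" using l(2) word_ball_mult[OF S_subset gh(1,3)] by blast
  then show "?\<delta> X Z \<le> ?\<delta> X Y + ?\<delta> Y Z" using k(1) m(1) l(1) XY Z by simp
qed

end

text \<open>A path between different components runs through their base points \<open>b n\<close>
  and \<open>b m\<close> and pays \<open>n + m\<close> for the jump, which is positive because the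
  indices differ.\<close>

lemma Metric_space_disjoint_union:
  fixes \<delta> :: "nat \<Rightarrow> 'x \<Rightarrow> 'x \<Rightarrow> real"
  assumes \<delta>: "\<And>n. Metric_space (A n) (\<delta> n)" and b: "\<And>n. b n \<in> A n"
  shows "Metric_space (\<Union>n. {n} \<times> A n) (\<lambda>(n, x) (m, y).
    if n = m then \<delta> n x y else \<delta> n x (b n) + \<delta> m y (b m) + real n + real m)"
    (is "Metric_space _ ?D")
proof
  note nonneg = Metric_space.nonneg[OF \<delta>] and commute = Metric_space.commute[OF \<delta>]
    and triangle = Metric_space.triangle[OF \<delta>]
  show "0 \<le> ?D p q" for p q using nonneg by (auto split: prod.split)
  show "?D p q = ?D q p" for p q using commute by (auto split: prod.split)
  show "?D p q = 0 \<longleftrightarrow> p = q" if mem: "p \<in> (\<Union>n. {n} \<times> A n)" "q \<in> (\<Union>n. {n} \<times> A n)" for p q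
  proof -
    obtain n x m y where pq: "p = (n, x)" "q = (m, y)" "x \<in> A n" "y \<in> A m" using mem by auto
    show ?thesis
    proof (cases "n = m")
      case True
      then show ?thesis using pq Metric_space.zero[OF \<delta>, of x n y] by simp
    next
      case False
      then have "0 < real n + real m" by auto
      then show ?thesis using pq False nonneg[of n x "b n"] nonneg[of m y "b m"] by simp
    qed
  qed
  show "?D p s \<le> ?D p q + ?D q s"
    if mem: "p \<in> (\<Union>n. {n} \<times> A n)" "q \<in> (\<Union>n. {n} \<times> A n)" "s \<in> (\<Union>n. {n} \<times> A n)" for p q s
  proof -
    obtain n x m y l z where pqs: "p = (n, x)" "q = (m, y)" "s = (l, z)"
      and A: "x \<in> A n" "y \<in> A m" "z \<in> A l" using mem by auto
    show ?thesis
    proof (cases "n = m"; cases "m = l")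
      assume "n = m" "m = l"
      then show ?thesis
        using A pqs triangle[of x n y z] by simp
    next
      assume "n = m" "m \<noteq> l"
      then show ?thesis
        using A pqs b[of n] triangle[of x n y "b n"] by simp
    next
      assume "n \<noteq> m" "m = l"
      then show ?thesis
        using A pqs b[of l] triangle[of z l y "b l"] commute[of l z y] by simp
    next
      \<comment> \<open>This includes \<open>n = l\<close>, where the detour through component
        \<open>m\<close> passes the base point of component \<open>n\<close> twice.\<close>
      assume "n \<noteq> m" "m \<noteq> l"
      then show ?thesis
        using A pqs b[of n] triangle[of x n "b n" z] commute[of n z "b n"] nonneg[of m y "b m"] by auto
    qed
  qed
qed

context finite_symmetric_generators
begin

lemma box_space_metric_exists:
  assumes \<sigma>: "\<And>n. subgroup (\<sigma> n) G"
  shows "\<exists>dB. box_space_metric G \<sigma> (word_metric G S) dB"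
proof -
  define \<delta> where "\<delta> = (\<lambda>n X Y. if X \<in> lcosets (\<sigma> n) \<and> Y \<in> lcosets (\<sigma> n)
    then set_distance (word_metric G S) X Y else 0)"
  define D where "D = (\<lambda>(n, X) (m, Y).
    if n = m then \<delta> n X Y else \<delta> n X (\<sigma> n) + \<delta> m Y (\<sigma> m) + real n + real m)"
  have \<delta>: "Metric_space (lcosets (\<sigma> n)) (\<delta> n)" for n
    unfolding \<delta>_def by (rule Metric_space_quotient[OF \<sigma>])
  have base: "\<sigma> n \<in> lcosets (\<sigma> n)" for n
    using lcos_mult_one[OF subgroup.subset[OF \<sigma>], of n] by (force simp: LCOSETS_def)
  have box: "box_space G \<sigma> = (\<Union>n. {n} \<times> lcosets (\<sigma> n))"
    by (simp add: box_space_def box_component_def)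
  have "Metric_space (box_space G \<sigma>) D"
    unfolding box D_def using \<delta> base by (rule Metric_space_disjoint_union)
  moreover have "D (n, X) (n, Y) = set_distance (word_metric G S) X Y"
    if "X \<in> lcosets (\<sigma> n)" "Y \<in> lcosets (\<sigma> n)" for n X Y
    using that by (simp add: D_def \<delta>_def)
  moreover have "\<exists>N. \<forall>n m. n \<noteq> m \<and> N \<le> n + m \<longrightarrow>
      C \<le> set_distance D (box_component G \<sigma> n) (box_component G \<sigma> m)" for C
  \<comment> \<open>Every jump between components costs at least \<open>n + m\<close>, so any bound
    beyond \<open>C\<close> will do.\<close>
  proof (intro exI[of _ "nat \<lceil>C\<rceil>"] allI impI)
    fix n m assume nm: "n \<noteq> m \<and> nat \<lceil>C\<rceil> \<le> n + m"
    then have C: "C \<le> real (n + m)" by linarith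
    show "C \<le> set_distance D (box_component G \<sigma> n) (box_component G \<sigma> m)"
      unfolding set_distance_def
    proof (rule cInf_greatest)
      show "{D a b |a b. a \<in> box_component G \<sigma> n \<and> b \<in> box_component G \<sigma> m} \<noteq> {}"
        using base by (auto simp: box_component_def)
      fix r assume "r \<in> {D a b |a b. a \<in> box_component G \<sigma> n \<and> b \<in> box_component G \<sigma> m}"
      then obtain X Y where "r = D (n, X) (m, Y)" by (auto simp: box_component_def)
      then show "C \<le> r"
        using nm C Metric_space.nonneg[OF \<delta>, of n X "\<sigma> n"] Metric_space.nonneg[OF \<delta>, of m Y "\<sigma> m"]
        by (simp add: D_def)
    qed
  qed
  ultimately show ?thesis unfolding box_space_metric_def by blast
qed

end

theorem theoremC:
  fixes G :: "('a, 'b) monoid_scheme"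
  assumes "finitely_generated_group G"
    and "virtually_nilpotent_group G"
  shows "\<exists>\<sigma>. regular_approximation G \<sigma> \<and>
           (\<exists>d dB. proper_right_invariant_metric G d \<and> box_space_metric G \<sigma> d dB) \<and>
           (\<forall>d dB. proper_right_invariant_metric G d \<and> box_space_metric G \<sigma> d dB \<longrightarrow>
              asdim (box_space G \<sigma>) dB < \<infinity>)"
proof -
  interpret group G using assms(1) by (simp add: finitely_generated_group_def)
  obtain S0 where S0: "finite S0" "S0 \<subseteq> carrier G" "generate G S0 = carrier G"
    using assms(1) unfolding finitely_generated_group_def by blast
  define S where "S = S0 \<union> m_inv G ` S0"
  have S: "finite S" "S \<subseteq> carrier G" using S0 by (auto simp: S_def)
  have S_inv: "inv\<^bsub>G\<^esub> s \<in> S" if "s \<in> S" for s using that S0(2) by (auto simp: S_def)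
  have gen: "generate G S = carrier G"
    using mono_generate[of S0 S] generate_incl[OF S(2)] S0(3) by (auto simp: S_def)
  interpret finite_symmetric_generators G S
    by unfold_locales (use S S_inv gen in auto)
  have "carrier G \<subseteq> (\<Union>n. word_ball G S n)"
    using generate_subset_word_balls[OF S(2) S_inv] gen by simp
  then have cnt: "countable (carrier G)"
    by (rule countable_subset) (intro countable_UN countableI_type countable_finite finite_word_ball S)
  obtain \<sigma> where \<sigma>: "regular_approximation G \<sigma>"
    using regular_approximation_exists[OF cnt]
      virtually_nilpotent_residually_finite[OF assms(2) S S_inv gen] by blast
  have fi: "finite_index_subgroup (\<sigma> n) G" and \<sigma>s: "subgroup (\<sigma> n) G" for n
    using \<sigma> by (auto simp: regular_approximation_def finite_index_subgroup_def)
  obtain C D where growth: "\<And>n. card (word_ball G S n) \<le> C * Suc n ^ D"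
    using virtually_nilpotent_polynomial_growth[OF assms(2) S] by blast
  have "0 < card (word_ball G S n)" for n
    using one_in_word_ball[of S n] finite_word_ball[OF S(1)] by (auto simp: card_gt_0_iff)
  \<comment> \<open>The factor is \<open>7\<close> because the packing argument compares balls of
    radius \<open>r\<close> and \<open>7 * r\<close>.\<close>
  then obtain M where M: "\<And>r0. \<exists>r\<ge>r0. card (word_ball G S (7 * r)) \<le> M * card (word_ball G S r)"
    using polynomial_growth_doubling[OF growth, of 7] by auto
  have "asdim (box_space G \<sigma>) dB < \<infinity>"
    if "proper_right_invariant_metric G d" "box_space_metric G \<sigma> d dB" for d dB
  proof -
    have "asdim_at_most (box_space G \<sigma>) dB M"
      by (rule asdim_box_space_at_most[OF is_group S S_inv gen M fi that])
    then have "asdim (box_space G \<sigma>) dB \<le> enat M"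
      unfolding asdim_def by (intro Inf_lower) blast
    then show ?thesis by (rule order_le_less_trans) simp
  qed
  \<comment> \<open>An actual box space metric, for the word metric, shows that the statement about
    all such metrics is not vacuous.\<close>
  moreover obtain dB where "box_space_metric G \<sigma> (word_metric G S) dB"
    using box_space_metric_exists[of \<sigma>] \<sigma>s by blast
  ultimately show ?thesis
    using \<sigma> proper_right_invariant_word_metric by blast
qed

end
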